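(* Let $n\ge 1$ and $N\ge 1$ be integers, and for each $k\in\{1,\dots,n\}$ let $L_k\in\mathbb{R}^{N\times N}$ be the graph Laplacian of a weighted directed graph on $N$ vertices that contains a connected spanning tree. Let $U_{\mathrm{ref}}\in\mathcal{R}\mathcal{H}_\infty$ and consider the $n$th-order serial consensus system $$\left(\prod_{k=1}^{n}(sI+L_k)\right)X(s)=U_{\mathrm{ref}}(s).$$ Then: (i) the poles of this closed-loop system are given by the union of the eigenvalues of the matrices $-L_k$, $k=1,\dots,n$; (ii) the solution $x(t)$ achieves $n$th order consensus.
   Context: A weighted directed graph on the vertex set $\mathcal{V}=\{1,\dots,N\}$ with edge set $\mathcal{E}$ is described by a nonnegative adjacency matrix $W\in\mathbb{R}^{N\times N}$ with $w_{i,j}>0$ if and only if $(j,i)\in\mathcal{E}$. Its graph Laplacian $L$ has entries $[L]_{i,j}=-w_{i,j}$ for $i\ne j$ and $[L]_{i,i}=\sum_{k\neq i}w_{i,k}$. The graph contains a connected spanning tree if there is a vertex $i\in\mathcal{V}$ from which there is a (directed) path to every other vertex $j\in\mathcal{V}$. $\mathcal{R}\mathcal{H}_\infty$ denotes the space of proper, real rational, stable transfer matrices (here $U_{\mathrm{ref}}$ is an $N$-vector of such functions). $X(s)$ is the Laplace transform of $x(t)=(x_1(t),\dots,x_N(t))^T$. Matrix products $\prod_{k=1}^n$ are ordered, with the factor $k=1$ leftmost. The poles of the closed-loop system are the roots $s\in\mathbb{C}$ of $\det\prod_{k=1}^n(sI+L_k)=0$, equivalently the eigenvalues of the state matrix of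 its state-space representation, the block upper bidiagonal matrix with diagonal blocks $-L_1,\dots,-L_n$ and identity blocks on the first block superdiagonal. The system achieves $n$th order consensus if $\lim_{t\to\infty}|x_i^{(k)}(t)-x_j^{(k)}(t)|=0$ for all $i,j\in\mathcal{V}$ and all $k\in\{0,1,\dots,n-1\}$, where $x_i^{(k)}$ denotes the $k$th time derivative of $x_i$. *)

theory Defs
  imports "HOL-Analysis.Analysis" "HOL-Computational_Algebra.Polynomial"
begin

section \<open>Weighted directed graphs and their Laplacians\<close>

definition adjacency_matrix :: "real^'n^'n \<Rightarrow> bool" where
  "adjacency_matrix W \<longleftrightarrow> (\<forall>i j. 0 \<le> W $ i $ j)"

text \<open>A pair \<open>(j, i)\<close> is an edge from \<open>j\<close> to \<open>i\<close>; its weight is stored in row \<open>i\<close>, column \<open>j\<close>.\<close>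

definition edges :: "real^'n^'n \<Rightarrow> ('n \<times> 'n) set" where
  "edges W = {(j, i). W $ i $ j > 0}"

definition graph_laplacian :: "real^'n^'n \<Rightarrow> real^'n^'n" where
  "graph_laplacian W =
     (\<chi> i j. if i = j then (\<Sum>k\<in>UNIV - {i}. W $ i $ k) else - W $ i $ j)"

definition has_spanning_tree :: "real^'n^'n \<Rightarrow> bool" where
  "has_spanning_tree W \<longleftrightarrow> (\<exists>r. \<forall>j. j \<noteq> r \<longrightarrow> (r, j) \<in> (edges W)\<^sup>+)"

definition laplacian_of_rooted_graph :: "real^'n^'n \<Rightarrow> bool" where
  "laplacian_of_rooted_graph L \<longleftrightarrow>
     (\<exists>W. adjacency_matrix W \<and> has_spanning_tree W \<and> L = graph_laplacian W)"


section \<open>Complex matrices\<close>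

definition complex_matrix :: "real^'n^'n \<Rightarrow> complex^'n^'n" where
  "complex_matrix A = map_matrix complex_of_real A"

definition eigenvalues :: "complex^'n^'n \<Rightarrow> complex set" where
  "eigenvalues A = {z. \<exists>v. v \<noteq> 0 \<and> A *v v = z *s v}"

text \<open>The ordered product \<open>A 1 ** A 2 ** \<dots> ** A n\<close>. The library's \<open>prod\<close> does not apply:
  the multiplication \<open>*\<close> on \<open>complex^'n^'n\<close> is entrywise.\<close>

primrec matrix_prod :: "(nat \<Rightarrow> complex^'n^'n) \<Rightarrow> nat \<Rightarrow> complex^'n^'n" where
  "matrix_prod A 0 = mat 1"
| "matrix_prod A (Suc n) = matrix_prod A n ** A (Suc n)"


section \<open>Stable transfer matrices\<close>

text \<open>A real rational function is represented by its values on \<open>\<complex>\<close>; its value at a root of the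
  denominator \<open>q\<close> is irrelevant. Demanding that \<open>q\<close> has no root in the closed right half-plane is
  stability, since \<open>p\<close> and \<open>q\<close> may be chosen coprime.\<close>

definition RH_inf :: "(complex \<Rightarrow> complex) set" where
  "RH_inf = {G. \<exists>p q :: real poly.
     q \<noteq> 0 \<and> degree p \<le> degree q \<and>
     (\<forall>s. poly (map_poly complex_of_real q) s = 0 \<longrightarrow> Re s < 0) \<and>
     (\<forall>s. poly (map_poly complex_of_real q) s \<noteq> 0 \<longrightarrow>
        G s = poly (map_poly complex_of_real p) s / poly (map_poly complex_of_real q) s)}"

definition RH_inf_vec :: "(complex \<Rightarrow> complex^'n) set" where
  "RH_inf_vec = {U. \<forall>i. (\<lambda>s. U s $ i) \<in> RH_inf}"


section \<open>Laplace transform\<close>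

definition laplace_converges :: "(real \<Rightarrow> real^'n) \<Rightarrow> complex \<Rightarrow> bool" where
  "laplace_converges x s \<longleftrightarrow>
     (\<forall>i. set_integrable lborel {0..} (\<lambda>t. exp (- s * complex_of_real t) * complex_of_real (x t $ i)))"

definition laplace :: "(real \<Rightarrow> real^'n) \<Rightarrow> complex \<Rightarrow> complex^'n" where
  "laplace x s = (\<chi> i. LBINT t:{0..}. exp (- s * complex_of_real t) * complex_of_real (x t $ i))"


section \<open>Serial consensus\<close>

definition serial_matrix :: "nat \<Rightarrow> (nat \<Rightarrow> real^'n^'n) \<Rightarrow> complex \<Rightarrow> complex^'n^'n" where
  "serial_matrix n L s = matrix_prod (\<lambda>k. mat s + complex_matrix (L k)) n"

definition closed_loop_poles :: "nat \<Rightarrow> (nat \<Rightarrow> real^'n^'n) \<Rightarrow> complex set" where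
  "closed_loop_poles n L = {s. det (serial_matrix n L s) = 0}"

text \<open>A time-domain solution is a signal whose Laplace transform exists and satisfies the equation
  on some right half-plane. The transform determines a signal only up to null sets;
  continuity at positive times selects the unique regular representative. It is not required
  at time 0 because a proper, not strictly proper input contains an impulse, which makes the
  derivative of order \<open>n - 1\<close> (for \<open>n = 1\<close>, the signal itself) jump there.\<close>

definition serial_consensus_solution ::
  "nat \<Rightarrow> (nat \<Rightarrow> real^'n^'n) \<Rightarrow> (complex \<Rightarrow> complex^'n) \<Rightarrow> (real \<Rightarrow> real^'n) \<Rightarrow> bool" where
  "serial_consensus_solution n L U x \<longleftrightarrow>
     continuous_on {0<..} x \<and>
     (\<exists>a. \<forall>s. a < Re s \<longrightarrow>
        laplace_converges x s \<and> serial_matrix n L s *v laplace x s = U s)"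

text \<open>The first conjunct makes the derivatives of order up to \<open>n - 1\<close> genuine, as \<open>deriv\<close> is
  unspecified where a function is not differentiable.\<close>

definition achieves_consensus :: "nat \<Rightarrow> (real \<Rightarrow> real^'n) \<Rightarrow> bool" where
  "achieves_consensus n x \<longleftrightarrow>
     (\<forall>i k. Suc k < n \<longrightarrow> (\<forall>t>0. (deriv ^^ k) (\<lambda>t. x t $ i) field_differentiable at t)) \<and>
     (\<forall>i j. \<forall>k<n.
        ((\<lambda>t. \<bar>(deriv ^^ k) (\<lambda>t. x t $ i) t - (deriv ^^ k) (\<lambda>t. x t $ j) t\<bar>) \<longlongrightarrow> 0) at_top)"

end

theory Submission
  imports Defs "HOL-Computational_Algebra.Fundamental_Theorem_Algebra" "HOL-Probability.Levy"
begin

text \<open>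
  The poles are found from the multiplicativity of the determinant: the product of the factors
  \<open>s I + L\<^sub>k\<close> is singular exactly if one factor is, that is, if \<open>s\<close> is an
  eigenvalue of \<open>- L\<^sub>k\<close>.

  For consensus, the transform \<open>X\<close> of the solution results from the proper rational input by
  inverting one factor after the other. It is therefore a vector of strictly proper rational functions whose
  poles lie in the open left half-plane or at the origin, and the signal itself is, at positive times, an
  exponential polynomial; in particular it is smooth. The pole at the origin may have any order up to
  \<open>n\<close>, so the components may grow polynomially. They do so together:
  \<open>L\<^sub>k 1 = 0\<close>, and the spanning tree makes 0 a simple eigenvalue, so that this pole
  appears only in the direction of the all-ones vector \<open>1\<close>.

  The precise form of the last remark is \<open>consensus_step\<close>. If \<open>(s I + L) X = Z\<close>,
  then the vector \<open>y\<close> of the differences \<open>X\<^sub>i - X\<^sub>r\<close> to a reference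
  vertex solves \<open>(s I + M) y = Z - Z\<^sub>r 1\<close>, where the matrix \<open>M\<close>
  (\<open>disagreement_matrix\<close>) has all its eigenvalues in the open right half-plane
  (\<open>disagreement_matrix_eigenvalue\<close>): the nonzero eigenvalues of \<open>L\<close> lie there by
  Gershgorin's theorem, and 0 is excluded by a maximum principle along the paths of the spanning tree. Hence
  differences with stable poles on the right produce differences with stable poles on the left, for each factor
  in turn. Their inverse transforms decay exponentially together with all derivatives.

  Two facts connect this picture with signals. The entries of a resolvent
  \<open>(s - A)\<^sup>-\<^sup>1\<close> are partial fractions with poles at eigenvalues of \<open>A\<close>
  (\<open>resolvent_partial_fractions\<close>), which follows from Newton's interpolation form. And a signal
  that is continuous at positive times is determined there by its Laplace transform
  (\<open>laplace_transform_unique\<close>), which follows from the uniqueness theorem for characteristic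
  functions of probability measures.
\<close>

section \<open>Poles of the closed loop\<close>

lemma uminus_matrix_vector_mult:
  fixes A :: "complex^'n^'n"
  shows "(- A) *v v = - (A *v v)"
  using matrix_vector_mult_diff_rdistrib[of 0 A v] by simp

lemma eigenvalues_uminus:
  fixes A :: "complex^'n^'n"
  shows "z \<in> eigenvalues (- A) \<longleftrightarrow> - z \<in> eigenvalues A"
proof -
  have "- w = z *s v \<longleftrightarrow> w = - z *s v" for v w :: "complex^'n"
    by (metis minus_minus vec.scale_minus_left)
  then show ?thesis by (simp add: eigenvalues_def uminus_matrix_vector_mult)
qed

lemma det_eq_0_iff_kernel:
  fixes A :: "complex^'n^'n"
  shows "det A = 0 \<longleftrightarrow> (\<exists>v. v \<noteq> 0 \<and> A *v v = 0)"
proof -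
  have "det A \<noteq> 0 \<longleftrightarrow> (\<forall>v. A *v v = 0 \<longrightarrow> v = 0)"
    by (metis invertible_det_nz invertible_left_inverse matrix_left_invertible_ker)
  then show ?thesis by blast
qed

lemma mat_mult_vec: "mat (c::complex) *v v = c *s v"
  by (simp add: vec_eq_iff matrix_vector_mult_def mat_def if_distrib[of "\<lambda>x. x * _"] cong: if_cong)

lemma det_shift_eq_0_iff:
  fixes A :: "real^'n^'n"
  shows "det (mat s + complex_matrix A) = 0 \<longleftrightarrow> s \<in> eigenvalues (complex_matrix (- A))"
proof -
  have "complex_matrix (- A) = - complex_matrix A"
    by (simp add: complex_matrix_def map_matrix_def vec_eq_iff)
  moreover have "s *s v + w = 0 \<longleftrightarrow> - w = s *s v" for v w :: "complex^'n"
    by (metis add_eq_0_iff2 neg_equal_iff_equal minus_minus)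
  ultimately show ?thesis
    by (simp add: det_eq_0_iff_kernel eigenvalues_def matrix_vector_mult_add_rdistrib mat_mult_vec
        uminus_matrix_vector_mult)
qed

lemma det_matrix_prod: "det (matrix_prod A n) = (\<Prod>k\<in>{1..n}. det (A k))"
  by (induction n) (simp_all add: det_mul prod.nat_ivl_Suc')

lemma closed_loop_poles_eq:
  "closed_loop_poles n L = (\<Union>k\<in>{1..n}. eigenvalues (complex_matrix (- L k)))"
  unfolding closed_loop_poles_def serial_matrix_def
  by (auto simp: det_matrix_prod det_shift_eq_0_iff)

section \<open>Laplacians of graphs with a spanning tree\<close>

lemma graph_laplacian_mult:
  "(complex_matrix (graph_laplacian W) *v v) $ i = (\<Sum>j\<in>UNIV. of_real (W $ i $ j) * (v $ i - v $ j))"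
proof -
  have "(complex_matrix (graph_laplacian W) *v v) $ i
     = of_real (\<Sum>k\<in>UNIV - {i}. W $ i $ k) * v $ i + (\<Sum>j\<in>UNIV - {i}. - of_real (W $ i $ j) * v $ j)"
    unfolding matrix_vector_mult_def complex_matrix_def graph_laplacian_def map_matrix_def
    by (subst sum.remove[of UNIV i]) (auto intro!: sum.cong)
  also have "\<dots> = (\<Sum>j\<in>UNIV - {i}. of_real (W $ i $ j) * (v $ i - v $ j))"
    by (simp add: sum_distrib_left sum_distrib_right sum_negf sum_subtractf algebra_simps)
  also have "\<dots> = (\<Sum>j\<in>UNIV. of_real (W $ i $ j) * (v $ i - v $ j))"
    by (subst sum.remove[of UNIV i]) auto
  finally show ?thesis .
qed

lemma graph_laplacian_shift:
  "complex_matrix (graph_laplacian W) *v (v + (\<chi> i. c)) = complex_matrix (graph_laplacian W) *v v"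
  by (simp add: vec_eq_iff graph_laplacian_mult del: vector_add_component) simp

lemma finite_argmax:
  fixes f :: "'a::finite \<Rightarrow> real"
  shows "\<exists>i. \<forall>j. f j \<le> f i"
proof -
  have "Max (range f) \<in> range f" by (intro Max_in) auto
  then obtain i where "Max (range f) = f i" by (rule rangeE)
  then have "\<forall>j. f j \<le> f i" by (metis Max_ge finite finite_imageI rangeI)
  then show ?thesis by blast
qed

text \<open>Gershgorin's argument: with \<open>d\<close> the full row sum of the weights at an index where the eigenvector
  is largest, \<open>\<bar>d - z\<bar> \<le> d\<close>. This disc touches the imaginary axis only at the
  origin.\<close>

lemma graph_laplacian_eigenvalue:
  assumes W: "adjacency_matrix W" and z: "z \<in> eigenvalues (complex_matrix (graph_laplacian W))"
  shows "z = 0 \<or> Re z > 0"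
proof -
  obtain v where v: "v \<noteq> 0" "complex_matrix (graph_laplacian W) *v v = z *s v"
    using z by (auto simp: eigenvalues_def)
  obtain i where i: "\<And>j. norm (v $ j) \<le> norm (v $ i)"
    using finite_argmax[of "\<lambda>j. norm (v $ j)"] by blast
  have vi: "norm (v $ i) > 0"
  proof (rule ccontr)
    assume "\<not> norm (v $ i) > 0"
    then have "norm (v $ j) \<le> 0" for j using i[of j] by linarith
    then show False using v(1) by (simp add: vec_eq_iff)
  qed
  define d where "d = (\<Sum>j\<in>UNIV. W $ i $ j)"
  have d0: "d \<ge> 0" using W by (auto simp: d_def adjacency_matrix_def intro: sum_nonneg)
  have "z * v $ i = (\<Sum>j\<in>UNIV. of_real (W $ i $ j) * (v $ i - v $ j))"
    using arg_cong[OF v(2), of "\<lambda>x. x $ i"] by (simp add: graph_laplacian_mult)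
  then have "(d - z) * v $ i = (\<Sum>j\<in>UNIV. of_real (W $ i $ j) * v $ j)"
    by (simp add: d_def algebra_simps sum_subtractf sum_distrib_left)
  then have "norm (d - z) * norm (v $ i) \<le> (\<Sum>j\<in>UNIV. norm (of_real (W $ i $ j) * v $ j))"
    by (metis norm_mult norm_sum)
  also have "\<dots> \<le> (\<Sum>j\<in>UNIV. W $ i $ j * norm (v $ i))"
    using W i by (intro sum_mono) (auto simp: adjacency_matrix_def norm_mult intro!: mult_left_mono)
  also have "\<dots> = d * norm (v $ i)" by (simp add: d_def sum_distrib_right)
  finally have "norm (d - z) \<le> d" using vi by simp
  then have "(norm (d - z))\<^sup>2 \<le> d\<^sup>2" using d0 by (intro power_mono) auto
  then have *: "(Re z)\<^sup>2 + (Im z)\<^sup>2 \<le> 2 * d * Re z"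
    by (simp add: cmod_power2 power2_diff algebra_simps)
  show ?thesis
  proof (rule disjCI)
    assume "\<not> Re z > 0"
    then have "2 * d * Re z \<le> 0" using d0 by (intro mult_nonneg_nonpos) auto
    then have "(Re z)\<^sup>2 + (Im z)\<^sup>2 = 0" using * sum_power2_ge_zero[of "Re z" "Im z"] by linarith
    then show "z = 0" by (simp add: sum_power2_eq_zero_iff complex_eq_iff)
  qed
qed

text \<open>If \<open>(L v)\<^sub>i \<le> 0\<close> at an index \<open>i\<close> where \<open>v\<close> is maximal,
  then every in-neighbour of \<open>i\<close> is maximal as well. Going backwards along edges, maximality
  propagates to the root.\<close>

lemma graph_laplacian_max_principle:
  fixes v :: "real^'n"
  assumes W: "adjacency_matrix W" and root: "\<forall>j. j \<noteq> r \<longrightarrow> (r, j) \<in> (edges W)\<^sup>+"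
    and v: "\<And>i. (\<Sum>j\<in>UNIV. W $ i $ j * (v $ i - v $ j)) \<le> 0"
  shows "v $ i \<le> v $ r"
proof -
  obtain m where m: "\<And>j. v $ j \<le> v $ m"
    using finite_argmax[of "\<lambda>j. v $ j"] by blast
  have step: "v $ j = v $ m" if "(j, i) \<in> edges W" "v $ i = v $ m" for i j
  proof -
    have nn: "\<And>k. 0 \<le> W $ i $ k * (v $ i - v $ k)"
      using W m that(2) by (simp add: adjacency_matrix_def)
    then have "(\<Sum>k\<in>UNIV. W $ i $ k * (v $ i - v $ k)) = 0"
      using v[of i] by (intro antisym sum_nonneg) auto
    then have "W $ i $ j * (v $ i - v $ j) = 0"
      using nn by (simp add: sum_nonneg_eq_0_iff)
    then show ?thesis using that by (auto simp: edges_def)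
  qed
  have "v $ j = v $ m" if "(j, i) \<in> (edges W)\<^sup>+" "v $ i = v $ m" for i j
    using that by (induction rule: converse_trancl_induct) (auto dest: step)
  then have "v $ r = v $ m" using root by (cases "m = r") auto
  then show ?thesis using m by simp
qed

text \<open>The constant \<open>c\<close> vanishes, since \<open>L v\<close> is nonnegative at a maximum and nonpositive
  at a minimum of \<open>v\<close>; then the root carries both the maximum and the minimum of \<open>v\<close>.
  For \<open>c = 0\<close> this says that the kernel of \<open>L\<close> is spanned by the all-ones vector.
  Allowing \<open>c \<noteq> 0\<close> excludes a Jordan block at the eigenvalue 0 at the same time.\<close>

lemma graph_laplacian_constant_image:
  fixes v :: "complex^'n"
  assumes W: "adjacency_matrix W" and tree: "has_spanning_tree W"
    and v: "\<And>i. (complex_matrix (graph_laplacian W) *v v) $ i = c"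
  shows "v $ i = v $ j"
proof -
  obtain r where r: "\<forall>j. j \<noteq> r \<longrightarrow> (r, j) \<in> (edges W)\<^sup>+"
    using tree by (auto simp: has_spanning_tree_def)
  have real: "u $ i = u $ r" if u: "\<And>i. (\<Sum>j\<in>UNIV. W $ i $ j * (u $ i - u $ j)) = b" for u :: "real^'n" and b i
  proof -
    obtain m where m: "\<And>j. u $ j \<le> u $ m"
      using finite_argmax[of "\<lambda>j. u $ j"] by blast
    obtain l where l: "\<And>j. u $ l \<le> u $ j"
      using finite_argmax[of "\<lambda>j. - u $ j"] by auto
    have "b \<ge> 0" unfolding u[of m, symmetric]
      using W m by (intro sum_nonneg) (auto simp: adjacency_matrix_def)
    moreover have "b \<le> 0" unfolding u[of l, symmetric]
      using W l by (intro sum_nonpos) (auto simp: adjacency_matrix_def mult_nonneg_nonpos)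
    ultimately have b: "b = 0" by simp
    have "u $ i \<le> u $ r"
      using u b by (intro graph_laplacian_max_principle[OF W r]) auto
    moreover have "(- u) $ i \<le> (- u) $ r"
    proof (intro graph_laplacian_max_principle[OF W r])
      fix k
      have "(\<Sum>j\<in>UNIV. W $ k $ j * ((- u) $ k - (- u) $ j)) = - (\<Sum>j\<in>UNIV. W $ k $ j * (u $ k - u $ j))"
        unfolding sum_negf[symmetric] by (intro sum.cong) (auto simp: algebra_simps)
      then show "(\<Sum>j\<in>UNIV. W $ k $ j * ((- u) $ k - (- u) $ j)) \<le> 0" using u b by simp
    qed
    ultimately show ?thesis by simp
  qed
  have "(\<chi> i. Re (v $ i)) $ i = (\<chi> i. Re (v $ i)) $ r" for i
    using arg_cong[OF v, of Re] by (intro real[where b="Re c"]) (simp add: graph_laplacian_mult)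
  moreover have "(\<chi> i. Im (v $ i)) $ i = (\<chi> i. Im (v $ i)) $ r" for i
    using arg_cong[OF v, of Im] by (intro real[where b="Im c"]) (simp add: graph_laplacian_mult)
  ultimately have "v $ i = v $ r" for i by (simp add: complex_eq_iff)
  then show ?thesis by metis
qed

text \<open>Let \<open>A = L\<close> be a Laplacian. If \<open>y\<close> collects the differences
  \<open>x\<^sub>i - x\<^sub>r\<close>, then \<open>L x = L y\<close> and the differences of
  \<open>L x\<close> are \<open>L y - (L y)\<^sub>r 1\<close>. That operator annihilates the all-ones
  vector; adding \<open>y\<^sub>r 1\<close>, which is 0 for vectors of differences, moves this superfluous
  eigenvalue from 0 to 1.\<close>

definition disagreement_matrix :: "'n \<Rightarrow> complex^'n^'n \<Rightarrow> complex^'n^'n" where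
  "disagreement_matrix r A = (\<chi> i j. A $ i $ j - A $ r $ j + (if j = r then 1 else 0))"

lemma disagreement_matrix_mult:
  "(disagreement_matrix r A *v v) $ i = (A *v v) $ i - (A *v v) $ r + v $ r"
  by (simp add: disagreement_matrix_def matrix_vector_mult_def algebra_simps sum.distrib
      sum_subtractf if_distrib[of "\<lambda>x. _ * x"] cong: if_cong)

text \<open>An eigenvector with \<open>v\<^sub>r \<noteq> 0\<close> belongs to the eigenvalue 1, by row
  \<open>r\<close>. One with \<open>v\<^sub>r = 0\<close> is not constant and satisfies
  \<open>L v = z v + c 1\<close>. Here \<open>z = 0\<close> would make \<open>L v\<close> constant,
  and for \<open>z \<noteq> 0\<close> a constant shift turns \<open>v\<close> into an eigenvector of
  \<open>L\<close>.\<close>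

lemma disagreement_matrix_eigenvalue:
  assumes W: "adjacency_matrix W" "has_spanning_tree W"
    and z: "z \<in> eigenvalues (disagreement_matrix r (complex_matrix (graph_laplacian W)))"
  shows "Re z > 0"
proof -
  let ?A = "complex_matrix (graph_laplacian W)"
  obtain v where v: "v \<noteq> 0" "disagreement_matrix r ?A *v v = z *s v"
    using z by (auto simp: eigenvalues_def)
  have eq: "(?A *v v) $ i - (?A *v v) $ r + v $ r = z * v $ i" for i
    using arg_cong[OF v(2), of "\<lambda>x. x $ i"] by (simp add: disagreement_matrix_mult)
  show ?thesis
  proof (cases "v $ r = 0")
    case False
    then show ?thesis using eq[of r] by simp
  next
    case True
    define c where "c = (?A *v v) $ r"
    have nonconst: "\<exists>i. v $ i \<noteq> v $ r" using v(1) True by (auto simp: vec_eq_iff)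
    have zn: "z \<noteq> 0"
    proof
      assume "z = 0"
      then have "(?A *v v) $ i = c" for i using eq[of i] True by (simp add: c_def)
      then show False using graph_laplacian_constant_image[OF W] nonconst by blast
    qed
    \<comment> \<open>the shift absorbs \<open>c\<close>, because \<open>L\<close> does not see it while \<open>z *s _\<close> produces \<open>c\<close>\<close>
    define w where "w = v + (\<chi> i. c / z)"
    have "(?A *v w) $ i = (z *s w) $ i" for i
    proof -
      have "(?A *v w) $ i = z * v $ i + c"
        unfolding w_def graph_laplacian_shift using eq[of i] True
        unfolding c_def by (metis add.right_neutral diff_add_cancel)
      then show ?thesis using zn by (simp add: w_def distrib_left)
    qed
    then have "?A *v w = z *s w" by (simp add: vec_eq_iff)
    moreover have "w \<noteq> 0"
    proof
      assume "w = 0"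
      then have "w $ i = w $ r" for i by simp
      then show False using nonconst by (simp add: w_def)
    qed
    ultimately have "z \<in> eigenvalues ?A" by (auto simp: eigenvalues_def)
    then show ?thesis using graph_laplacian_eigenvalue[OF W(1)] zn by blast
  qed
qed

section \<open>Proper rational functions as partial fractions\<close>

text \<open>Transforms matter only as germs: functions of \<open>s\<close> that agree as soon as \<open>Re s\<close> is
  large are identified. This filter expresses that, and it also absorbs the values at poles, which division by
  zero makes meaningless.\<close>

abbreviation right_half_planes :: "complex filter" where
  "right_half_planes \<equiv> filtercomap Re at_top"

lemma eventually_right_half_planes_iff:
  "eventually P right_half_planes \<longleftrightarrow> (\<exists>a. \<forall>s. a < Re s \<longrightarrow> P s)"
  by (rule eventually_filtercomap_at_top_dense)

lemma eventually_Re_gt: "eventually (\<lambda>s. a < Re s) right_half_planes"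
  by (auto simp: eventually_right_half_planes_iff)

text \<open>Germs of strictly proper rational functions with poles in \<open>P\<close>. The inductive form allows products
  and inverse Laplace transforms to be treated term by term.\<close>

inductive_set partial_fractions :: "complex set \<Rightarrow> (complex \<Rightarrow> complex) set" for P where
  zero: "(\<lambda>s. 0) \<in> partial_fractions P"
| simple: "z \<in> P \<Longrightarrow> (\<lambda>s. c / (s - z) ^ Suc m) \<in> partial_fractions P"
| add: "F \<in> partial_fractions P \<Longrightarrow> G \<in> partial_fractions P \<Longrightarrow> (\<lambda>s. F s + G s) \<in> partial_fractions P"
| cong: "F \<in> partial_fractions P \<Longrightarrow> eventually (\<lambda>s. F s = G s) right_half_planes \<Longrightarrow>
    G \<in> partial_fractions P"

lemma partial_fractions_mono:
  assumes "F \<in> partial_fractions P" "P \<subseteq> Q"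
  shows "F \<in> partial_fractions Q"
  using assms by induction (auto intro: partial_fractions.intros simp del: power_Suc)

lemma partial_fractions_cmult:
  assumes "F \<in> partial_fractions P"
  shows "(\<lambda>s. c * F s) \<in> partial_fractions P"
  using assms
proof induction
  case zero
  then show ?case by (simp add: partial_fractions.zero)
next
  case (simple z b m)
  then show ?case using partial_fractions.simple[of z P "c * b" m] by simp
next
  case (add F G)
  then show ?case using partial_fractions.add[OF add.IH] by (simp add: distrib_left)
next
  case (cong F G)
  show ?case by (rule partial_fractions.cong[OF cong.IH]) (auto intro: eventually_mono[OF cong.hyps(2)])
qed

lemma partial_fractions_diff:
  "F \<in> partial_fractions P \<Longrightarrow> G \<in> partial_fractions P \<Longrightarrow> (\<lambda>s. F s - G s) \<in> partial_fractions P"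
  using partial_fractions.add[OF _ partial_fractions_cmult[of G P "-1"]] by simp

lemma partial_fractions_sum:
  "(\<And>j. j \<in> S \<Longrightarrow> F j \<in> partial_fractions P) \<Longrightarrow> (\<lambda>s. \<Sum>j\<in>S. F j s) \<in> partial_fractions P"
  by (induction S rule: infinite_finite_induct) (auto intro: partial_fractions.intros)

text \<open>The identity
  \<open>1 / ((s - y) (s - z)) = (1 / (s - y) - 1 / (s - z)) / (y - z)\<close> lowers the
  exponent of \<open>s - z\<close>.\<close>

lemma partial_fractions_simple_mult_simple:
  assumes "y \<in> P" "z \<in> P"
  shows "(\<lambda>s. 1 / (s - y) * (c / (s - z) ^ Suc m)) \<in> partial_fractions P"
proof (cases "y = z")
  case True
  then show ?thesis using partial_fractions.simple[OF assms(2), of c "Suc m"] by simp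
next
  case False
  show ?thesis
  proof (induction m)
    case 0
    have "(\<lambda>s. c / (y - z) * (1 / (s - y) ^ Suc 0 - 1 / (s - z) ^ Suc 0)) \<in> partial_fractions P"
      by (intro partial_fractions_cmult partial_fractions_diff partial_fractions.simple assms)
    then show ?case
    proof (rule partial_fractions.cong)
      show "eventually (\<lambda>s. c / (y - z) * (1 / (s - y) ^ Suc 0 - 1 / (s - z) ^ Suc 0)
          = 1 / (s - y) * (c / (s - z) ^ Suc 0)) right_half_planes"
        using eventually_Re_gt[of "Re y"] eventually_Re_gt[of "Re z"]
      proof eventually_elim
        case (elim s)
        then have "s \<noteq> y" "s \<noteq> z" by auto
        then show ?case using False by (simp add: divide_simps)
      qed
    qed
  next
    case (Suc m)
    have "(\<lambda>s. 1 / (y - z) * (1 / (s - y) * (c / (s - z) ^ Suc m) - c / (s - z) ^ Suc (Suc m)))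
        \<in> partial_fractions P"
      by (intro partial_fractions_cmult partial_fractions_diff partial_fractions.simple Suc assms)
    then show ?case
    proof (rule partial_fractions.cong)
      show "eventually (\<lambda>s. 1 / (y - z) * (1 / (s - y) * (c / (s - z) ^ Suc m) - c / (s - z) ^ Suc (Suc m))
          = 1 / (s - y) * (c / (s - z) ^ Suc (Suc m))) right_half_planes"
        using eventually_Re_gt[of "Re y"] eventually_Re_gt[of "Re z"]
      proof eventually_elim
        case (elim s)
        then have "s - y \<noteq> 0" "s - z \<noteq> 0" by auto
        define b where "b = c / (s - z) ^ Suc m"
        have "1 / (y - z) * (1 / (s - y) * b - b / (s - z)) = 1 / (s - y) * (b / (s - z))"
          using \<open>s - y \<noteq> 0\<close> \<open>s - z \<noteq> 0\<close> False by (simp add: divide_simps) (simp add: algebra_simps)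
        then show ?case by (simp add: b_def mult.commute)
      qed
    qed
  qed
qed

lemma partial_fractions_mult_linear:
  assumes "G \<in> partial_fractions P" "z \<in> P"
  shows "(\<lambda>s. 1 / (s - z) * G s) \<in> partial_fractions P"
  using assms(1)
proof induction
  case zero
  then show ?case by (simp add: partial_fractions.zero)
next
  case (simple y c m)
  then show ?case by (rule partial_fractions_simple_mult_simple[OF assms(2)])
next
  case (add F G)
  show ?case using partial_fractions.add[OF add.IH] by (simp add: add_divide_distrib)
next
  case (cong F G)
  show ?case by (rule partial_fractions.cong[OF cong.IH]) (auto intro: eventually_mono[OF cong.hyps(2)])
qed

lemma partial_fractions_mult:
  assumes "F \<in> partial_fractions P" and G: "G \<in> partial_fractions P"
  shows "(\<lambda>s. F s * G s) \<in> partial_fractions P"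
  using assms(1)
proof induction
  case zero
  then show ?case by (simp add: partial_fractions.zero)
next
  case (simple z c m)
  show ?case
  proof (induction m)
    case 0
    show ?case using partial_fractions_cmult[OF partial_fractions_mult_linear[OF G simple], of c] by simp
  next
    case (Suc m)
    show ?case using partial_fractions_mult_linear[OF Suc simple] by (simp add: ac_simps)
  qed
next
  case (add F G)
  show ?case using partial_fractions.add[OF add.IH] by (simp add: distrib_right)
next
  case (cong F G)
  show ?case by (rule partial_fractions.cong[OF cong.IH]) (auto intro: eventually_mono[OF cong.hyps(2)])
qed

text \<open>A constant plus a strictly proper part. Strictly proper functions form an ideal in this ring; this keeps the
  transform of the state strictly proper when the input is merely proper.\<close>

definition proper_fractions :: "complex set \<Rightarrow> (complex \<Rightarrow> complex) set" where
  "proper_fractions P = {F. \<exists>c. (\<lambda>s. F s - c) \<in> partial_fractions P}"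

lemma partial_imp_proper: "F \<in> partial_fractions P \<Longrightarrow> F \<in> proper_fractions P"
  by (auto simp: proper_fractions_def intro: exI[of _ 0])

lemma proper_fractions_mono: "F \<in> proper_fractions P \<Longrightarrow> P \<subseteq> Q \<Longrightarrow> F \<in> proper_fractions Q"
  by (auto simp: proper_fractions_def intro: partial_fractions_mono)

lemma proper_fractions_cong:
  assumes "F \<in> proper_fractions P" "eventually (\<lambda>s. F s = G s) right_half_planes"
  shows "G \<in> proper_fractions P"
proof -
  obtain c where "(\<lambda>s. F s - c) \<in> partial_fractions P" using assms by (auto simp: proper_fractions_def)
  then have "(\<lambda>s. G s - c) \<in> partial_fractions P"
    by (rule partial_fractions.cong) (auto intro: eventually_mono[OF assms(2)])
  then show ?thesis by (auto simp: proper_fractions_def)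
qed

lemma proper_fractions_diff:
  assumes "F \<in> proper_fractions P" "G \<in> proper_fractions P"
  shows "(\<lambda>s. F s - G s) \<in> proper_fractions P"
proof -
  obtain b c where "(\<lambda>s. F s - b) \<in> partial_fractions P" "(\<lambda>s. G s - c) \<in> partial_fractions P"
    using assms by (auto simp: proper_fractions_def)
  then have "(\<lambda>s. (F s - b) - (G s - c)) \<in> partial_fractions P" by (rule partial_fractions_diff)
  then show ?thesis
    by (auto simp: proper_fractions_def algebra_simps intro!: exI[of _ "b - c"])
qed

lemma partial_fractions_mult_proper:
  assumes "F \<in> partial_fractions P" "G \<in> proper_fractions P"
  shows "(\<lambda>s. F s * G s) \<in> partial_fractions P"
proof -
  obtain c where "(\<lambda>s. G s - c) \<in> partial_fractions P" using assms by (auto simp: proper_fractions_def)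
  then have "(\<lambda>s. F s * (G s - c) + c * F s) \<in> partial_fractions P"
    by (intro partial_fractions.add partial_fractions_mult partial_fractions_cmult assms)
  then show ?thesis by (simp add: algebra_simps)
qed

text \<open>Splitting off one linear factor by synthetic division, \<open>p = (s - z) q + r\<close> with constant
  \<open>r\<close>, leaves a proper fraction over the remaining factors and \<open>r\<close> over all of them.\<close>

lemma rational_function_proper:
  assumes "set zs \<subseteq> P" "degree p \<le> length zs"
  shows "(\<lambda>s. poly p s / (\<Prod>z\<leftarrow>zs. s - z)) \<in> proper_fractions P"
  using assms
proof (induction zs arbitrary: p)
  case Nil
  then obtain a where "p = [:a:]" by (auto elim: degree_eq_zeroE)
  then show ?case by (auto simp: proper_fractions_def intro!: exI[of _ a] partial_fractions.zero)
next
  case (Cons z zs)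
  define q where "q = synthetic_div p z"
  define r where "r = poly p z"
  have p: "poly p s = (s - z) * poly q s + r" for s
    using arg_cong[OF synthetic_div_correct'[of z p], of "\<lambda>p. poly p s"]
    by (simp add: q_def r_def algebra_simps)
  have deg: "degree q \<le> length zs" using Cons.prems by (simp add: q_def degree_synthetic_div)
  have IH: "(\<lambda>s. poly p' s / (\<Prod>z\<leftarrow>zs. s - z)) \<in> proper_fractions P" if "degree p' \<le> length zs" for p'
    using Cons that by simp
  \<comment> \<open>the sign of \<open>r\<close> turns the sum \<open>q / \<dots> + r / \<dots>\<close> into a difference\<close>
  have "(\<lambda>s. 1 / (s - z) ^ Suc 0 * (poly [:- r:] s / (\<Prod>z\<leftarrow>zs. s - z))) \<in> partial_fractions P"
    using Cons.prems by (intro partial_fractions_mult_proper partial_fractions.simple IH) auto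
  then have "(\<lambda>s. poly q s / (\<Prod>z\<leftarrow>zs. s - z) - 1 / (s - z) ^ Suc 0 * (poly [:- r:] s / (\<Prod>z\<leftarrow>zs. s - z)))
      \<in> proper_fractions P"
    by (intro proper_fractions_diff IH deg partial_imp_proper)
  then show ?case
  proof (rule proper_fractions_cong)
    show "eventually (\<lambda>s. poly q s / (\<Prod>z\<leftarrow>zs. s - z) - 1 / (s - z) ^ Suc 0 * (poly [:- r:] s / (\<Prod>z\<leftarrow>zs. s - z))
       = poly p s / (\<Prod>z\<leftarrow>z # zs. s - z)) right_half_planes"
      using eventually_Re_gt[of "Re z"]
    proof eventually_elim
      case (elim s)
      then have "s - z \<noteq> 0" by auto
      then show ?case unfolding p
        by (cases "(\<Prod>z\<leftarrow>zs. s - z) = 0") (simp_all add: divide_simps)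
    qed
  qed
qed

lemma RH_inf_proper:
  assumes "G \<in> RH_inf"
  shows "G \<in> proper_fractions {z. Re z < 0}"
proof -
  let ?c = "map_poly complex_of_real"
  obtain p q :: "real poly" where q: "q \<noteq> 0" and deg: "degree p \<le> degree q"
    and stable: "\<And>s. poly (?c q) s = 0 \<Longrightarrow> Re s < 0"
    and G: "\<And>s. poly (?c q) s \<noteq> 0 \<Longrightarrow> G s = poly (?c p) s / poly (?c q) s"
    using assms by (auto simp: RH_inf_def)
  have "?c q \<noteq> 0" using q by (simp add: map_poly_eq_0_iff)
  then obtain R where R: "size R = degree (?c q)"
    "?c q = smult (lead_coeff (?c q)) (\<Prod>x\<in>#R. [:-x, 1:])"
    using alg_closed_imp_factorization by blast
  obtain zs where zs: "R = mset zs" by (metis ex_mset)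
  define c where "c = lead_coeff (?c q)"
  have c: "c \<noteq> 0" using \<open>?c q \<noteq> 0\<close> by (simp add: c_def)
  have "poly (\<Prod>x\<in>#mset ys. [:-x, 1:]) s = (\<Prod>z\<leftarrow>ys. s - z)" for s :: complex and ys
    by (induction ys) (simp_all add: algebra_simps)
  then have poly_q: "poly (?c q) s = c * (\<Prod>z\<leftarrow>zs. s - z)" for s
    by (subst R(2)) (simp add: zs c_def)
  have "set zs \<subseteq> {z. Re z < 0}"
    by (auto intro!: stable simp: poly_q prod_list_zero_iff)
  moreover have "degree (smult (1 / c) (?c p)) \<le> length zs"
    using deg R(1) zs by (simp add: degree_map_poly)
  ultimately have "(\<lambda>s. poly (smult (1 / c) (?c p)) s / (\<Prod>z\<leftarrow>zs. s - z)) \<in> proper_fractions {z. Re z < 0}"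
    by (rule rational_function_proper)
  then show ?thesis
  proof (rule proper_fractions_cong)
    show "eventually (\<lambda>s. poly (smult (1 / c) (?c p)) s / (\<Prod>z\<leftarrow>zs. s - z) = G s) right_half_planes"
      using eventually_Re_gt[of 0]
    proof eventually_elim
      case (elim s)
      then have "poly (?c q) s \<noteq> 0" using stable[of s] by auto
      from G[OF this] show ?case by (simp add: poly_q)
    qed
  qed
qed

section \<open>Resolvents in Newton form\<close>

text \<open>The vector \<open>p(A) v\<close>, in Horner form.\<close>

definition poly_action :: "complex^'n^'n \<Rightarrow> complex^'n \<Rightarrow> complex poly \<Rightarrow> complex^'n" where
  "poly_action A v p = fold_coeffs (\<lambda>a w. a *s v + A *v w) p 0"

lemma poly_action_0 [simp]: "poly_action A v 0 = 0"
  by (simp add: poly_action_def)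

lemma poly_action_pCons [simp]: "poly_action A v (pCons a p) = a *s v + A *v poly_action A v p"
  by (cases "p = 0 \<and> a = 0") (auto simp: poly_action_def)

lemma poly_action_add: "poly_action A v (p + q) = poly_action A v p + poly_action A v q"
proof (induction p arbitrary: q rule: pCons_induct)
  case 0
  then show ?case by simp
next
  case (pCons a p)
  obtain b q' where "q = pCons b q'" by (cases q)
  then show ?case using pCons.IH
    by (simp add: matrix_vector_right_distrib vec.scale_left_distrib)
qed

lemma poly_action_smult: "poly_action A v (smult c p) = c *s poly_action A v p"
  by (induction p rule: pCons_induct) (simp_all add: vec.scale_right_distrib vec.scale)

lemma poly_action_sum: "poly_action A v (sum f S) = (\<Sum>i\<in>S. poly_action A v (f i))"
  by (induction S rule: infinite_finite_induct) (simp_all add: poly_action_add)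

lemma poly_action_monom: "poly_action A v (monom c k) = c *s (((*v) A) ^^ k) v"
  by (induction k) (simp_all add: monom_0 monom_Suc vec.scale)

lemma poly_action_linear_factor:
  "poly_action A v ([:- z, 1:] * p) = A *v poly_action A v p - z *s poly_action A v p"
proof -
  have "[:- z, 1:] * p = pCons 0 p + smult (- z) p" by simp
  then show ?thesis
    by (simp only: poly_action_add poly_action_smult poly_action_pCons) (simp add: vec.scale_minus_left)
qed

text \<open>The vectors \<open>v, A v, \<dots>, A\<^sup>N v\<close> are either not distinct or linearly dependent, as
  there are more of them than the dimension \<open>N\<close>. Both cases give a relation, hence a polynomial.\<close>

lemma annihilating_poly_exists:
  fixes A :: "complex^'n^'n"
  shows "\<exists>p. p \<noteq> 0 \<and> poly_action A v p = 0"
proof -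
  define u where "u k = (((*v) A) ^^ k) v" for k
  show ?thesis
  proof (cases "inj_on u {..CARD('n)}")
    case False
    then obtain i j where ij: "i \<noteq> j" "u i = u j" by (auto simp: inj_on_def)
    define p :: "complex poly" where "p = monom 1 i + monom (-1) j"
    have "coeff p i = 1" using ij by (simp add: p_def)
    then have "p \<noteq> 0" by auto
    moreover have "poly_action A v p = 0"
      using ij by (simp add: p_def poly_action_add poly_action_monom u_def)
    ultimately show ?thesis by blast
  next
    case True
    have "card (u ` {..CARD('n)}) > vec.dim (u ` {..CARD('n)})"
      using card_image[OF True] vec.dim_subset[OF subset_UNIV, of "u ` {..CARD('n)}"]
      by (simp add: vec_dim_card card_cart_basis)
    then have "vec.dependent (u ` {..CARD('n)})"
      using vec.dependent_biggerset_general by blast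
    then obtain c w where c: "(\<Sum>x\<in>u ` {..CARD('n)}. c x *s x) = 0"
      and w: "w \<in> u ` {..CARD('n)}" "c w \<noteq> 0"
      using vec.dependent_finite[of "u ` {..CARD('n)}"] by blast
    define p where "p = (\<Sum>k\<le>CARD('n). monom (c (u k)) k)"
    obtain k where k: "k \<le> CARD('n)" "c (u k) \<noteq> 0" using w by auto
    have "coeff p k = c (u k)"
      using k by (simp add: p_def coeff_sum if_distrib cong: if_cong)
    then have "p \<noteq> 0" using k by auto
    moreover have "poly_action A v p = 0"
      using c unfolding sum.reindex[OF True] by (simp add: p_def poly_action_sum poly_action_monom u_def)
    ultimately show ?thesis by blast
  qed
qed

text \<open>The vector \<open>(A - z\<^sub>1) \<dots> (A - z\<^sub>m) v\<close>.\<close>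

primrec apply_factors :: "complex^'n^'n \<Rightarrow> complex list \<Rightarrow> complex^'n \<Rightarrow> complex^'n" where
  "apply_factors A [] v = v"
| "apply_factors A (z # zs) v = apply_factors A zs (A *v v - z *s v)"

lemma apply_factors_commute:
  "apply_factors A zs (A *v v - z *s v) = A *v apply_factors A zs v - z *s apply_factors A zs v"
proof (induction zs arbitrary: v)
  case (Cons y ys)
  have "A *v (A *v v - z *s v) - y *s (A *v v - z *s v) = A *v (A *v v - y *s v) - z *s (A *v v - y *s v)"
    by (simp add: algebra_simps vec.scale vec.scale_right_diff_distrib)
  then show ?case using Cons[of "A *v v - y *s v"] by simp
qed simp

text \<open>A substitute for the Cayley-Hamilton theorem. Over \<open>\<complex>\<close> an annihilating polynomial splits
  into linear factors, and a factor whose root is not an eigenvalue is injective and can be dropped.\<close>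

lemma annihilating_eigenvalues_exist:
  fixes A :: "complex^'n^'n"
  shows "\<exists>zs. set zs \<subseteq> eigenvalues A \<and> apply_factors A zs v = 0"
proof -
  obtain p where p: "p \<noteq> 0" "poly_action A v p = 0"
    using annihilating_poly_exists by blast
  obtain R where R: "p = smult (lead_coeff p) (\<Prod>x\<in>#R. [:-x, 1:])"
    using alg_closed_imp_factorization[OF p(1)] by blast
  obtain zs where zs: "R = mset zs" by (metis ex_mset)
  have "poly_action A v (\<Prod>x\<in>#mset zs. [:-x, 1:]) = apply_factors A zs v" for zs
  proof (induction zs)
    case Nil
    then show ?case by (simp add: one_pCons)
  next
    case (Cons z zs)
    then show ?case by (simp only: mset.simps image_mset_add_mset prod_mset.add_mset
        poly_action_linear_factor apply_factors.simps apply_factors_commute)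
  qed
  moreover have "lead_coeff p *s poly_action A v (\<Prod>x\<in>#R. [:-x, 1:]) = 0"
    using R p(2) by (metis poly_action_smult)
  ultimately have "apply_factors A zs v = 0"
    using p(1) zs by simp
  then show ?thesis
  proof (induction zs arbitrary: v)
    case Nil
    then show ?case by (intro exI[of _ "[]"]) auto
  next
    case (Cons z zs)
    show ?case
    proof (cases "z \<in> eigenvalues A")
      case True
      obtain ys where "set ys \<subseteq> eigenvalues A" "apply_factors A ys (A *v v - z *s v) = 0"
        using Cons.IH Cons.prems by (metis apply_factors.simps(2))
      then show ?thesis using True by (intro exI[of _ "z # ys"]) auto
    next
      case False
      have "A *v apply_factors A zs v = z *s apply_factors A zs v"
        using Cons.prems by (simp add: apply_factors_commute)
      then have "apply_factors A zs v = 0" using False by (auto simp: eigenvalues_def)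
      then show ?thesis by (rule Cons.IH)
    qed
  qed
qed

text \<open>The resolvent applied to \<open>v\<close>, in Newton form:
  \<open>\<Sum>\<^sub>k (A - z\<^sub>1) \<dots> (A - z\<^sub>k) v / ((s - z\<^sub>1) \<dots> (s - z\<^sub>k\<^sub>+\<^sub>1))\<close>.
  In this form the dependence on \<open>s\<close> is visibly strictly proper with poles among the
  \<open>z\<^sub>k\<close>.\<close>

primrec newton_resolvent :: "complex^'n^'n \<Rightarrow> complex list \<Rightarrow> complex^'n \<Rightarrow> complex \<Rightarrow> complex^'n" where
  "newton_resolvent A [] v s = 0"
| "newton_resolvent A (z # zs) v s =
     (1 / (s - z)) *s (v + newton_resolvent A zs (A *v v - z *s v) s)"

text \<open>With \<open>v\<^sub>0 = v\<close> and
  \<open>v\<^sub>k\<^sub>+\<^sub>1 = (A - z\<^sub>k\<^sub>+\<^sub>1) v\<^sub>k\<close> one has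
  \<open>(s - A) v\<^sub>k = (s - z\<^sub>k\<^sub>+\<^sub>1) v\<^sub>k - v\<^sub>k\<^sub>+\<^sub>1\<close>;
  the sum telescopes, and the last term vanishes because the factors annihilate \<open>v\<close>.\<close>

lemma newton_resolvent_eq:
  assumes "apply_factors A zs v = 0" "s \<notin> set zs"
  shows "s *s newton_resolvent A zs v s - A *v newton_resolvent A zs v s = v"
  using assms
proof (induction zs arbitrary: v)
  case (Cons z zs)
  define r where "r = newton_resolvent A zs (A *v v - z *s v) s"
  have r: "s *s r - A *v r = A *v v - z *s v"
    using Cons by (simp add: r_def)
  have "s *s newton_resolvent A (z # zs) v s - A *v newton_resolvent A (z # zs) v s
      = (1 / (s - z)) *s ((s *s v - A *v v) + (s *s r - A *v r))"
    by (simp add: r_def[symmetric] vec.scale algebra_simps vec.scale_right_distrib vec.scale_right_diff_distrib)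
  also have "\<dots> = (1 / (s - z)) *s ((s - z) *s v)"
    unfolding r by (simp add: vec.scale_left_diff_distrib)
  also have "\<dots> = v" using Cons.prems by (simp only: vec.scale_scale) simp
  finally show ?case .
qed simp

lemma newton_resolvent_partial_fractions:
  "set zs \<subseteq> P \<Longrightarrow> (\<lambda>s. newton_resolvent A zs v s $ i) \<in> partial_fractions P"
proof (induction zs arbitrary: v)
  case Nil
  then show ?case by (simp add: partial_fractions.zero)
next
  case (Cons z zs)
  have "(\<lambda>s. v $ i / (s - z) ^ Suc 0 + 1 / (s - z) * newton_resolvent A zs (A *v v - z *s v) s $ i)
      \<in> partial_fractions P"
    using Cons by (intro partial_fractions.add partial_fractions.simple partial_fractions_mult_linear) auto
  then show ?case by (simp add: add_divide_distrib)
qed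

text \<open>On the unit vectors the Newton form gives the columns of the resolvent. The bound on \<open>P\<close> ensures
  that \<open>s - A\<close> is injective throughout a right half-plane, so that the solution is unique there.\<close>

lemma resolvent_partial_fractions:
  fixes A :: "complex^'n^'n"
  assumes A: "eigenvalues A \<subseteq> P" and P: "P \<subseteq> {z. Re z \<le> 0}"
    and eq: "eventually (\<lambda>s. s *s X s - A *v X s = B s) right_half_planes"
    and B: "\<And>j. (\<lambda>s. B s $ j) \<in> proper_fractions P"
  shows "(\<lambda>s. X s $ i) \<in> partial_fractions P"
proof -
  have "\<forall>j. \<exists>zs. set zs \<subseteq> eigenvalues A \<and> apply_factors A zs (axis j 1) = 0"
    using annihilating_eigenvalues_exist by blast
  then obtain zs where zs: "\<And>j. set (zs j) \<subseteq> eigenvalues A" "\<And>j. apply_factors A (zs j) (axis j 1) = 0"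
    by metis
  define R where "R j = newton_resolvent A (zs j) (axis j 1)" for j
  have "(\<lambda>s. \<Sum>j\<in>UNIV. R j s $ i * B s $ j) \<in> partial_fractions P"
    using zs A unfolding R_def
    by (intro partial_fractions_sum partial_fractions_mult_proper newton_resolvent_partial_fractions B) blast
  then show ?thesis
  proof (rule partial_fractions.cong)
    show "eventually (\<lambda>s. (\<Sum>j\<in>UNIV. R j s $ i * B s $ j) = X s $ i) right_half_planes"
      using eq eventually_Re_gt[of 0]
    proof eventually_elim
      case (elim s)
      then have s: "s \<notin> eigenvalues A" using A P by force
      then have R: "s *s R j s - A *v R j s = axis j 1" for j
        using newton_resolvent_eq[OF zs(2)] zs(1) by (metis R_def subsetD)
      define Y where "Y = (\<Sum>j\<in>UNIV. B s $ j *s R j s)"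
      have "s *s Y - A *v Y = (\<Sum>j\<in>UNIV. B s $ j *s (s *s R j s - A *v R j s))"
        by (simp add: Y_def vec.sum vec.scale vec.scale_sum_right vec.scale_right_diff_distrib
            sum_subtractf mult.commute)
      also have "\<dots> = B s" by (simp add: R basis_expansion)
      finally have "A *v (Y - X s) = s *s (Y - X s)"
        using elim(1) by (simp add: vec.diff vec.scale_right_diff_distrib algebra_simps)
      then have "Y - X s = 0" using s unfolding eigenvalues_def by blast
      then have "X s $ i = Y $ i" by simp
      then show ?case by (simp add: Y_def mult.commute)
    qed
  qed
qed

section \<open>Inverse Laplace transforms of partial fractions\<close>

lemma tendsto_power_mult_exp:
  assumes "Re z > 0"
  shows "((\<lambda>t. of_real t ^ m * exp (- z * of_real t)) \<longlongrightarrow> (0::complex)) at_top"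
proof -
  let ?r = "Re z"
  have "((\<lambda>t. (1 / ?r ^ m) * ((?r * t) ^ m / exp (?r * t))) \<longlongrightarrow> (1 / ?r ^ m) * 0) at_top"
    by (intro tendsto_mult tendsto_const filterlim_compose[OF tendsto_power_div_exp_0]
        filterlim_tendsto_pos_mult_at_top[OF tendsto_const assms filterlim_ident])
  then have "((\<lambda>t. t ^ m * exp (- ?r * t)) \<longlongrightarrow> 0) at_top"
    using assms by (simp add: power_mult_distrib exp_minus field_simps)
  then have "((\<lambda>t. norm (of_real t ^ m * exp (- z * of_real t))) \<longlongrightarrow> 0) at_top"
  proof (rule Lim_transform_eventually)
    show "\<forall>\<^sub>F t in at_top. t ^ m * exp (- ?r * t) = norm (of_real t ^ m * exp (- z * of_real t))"
      using eventually_ge_at_top[of 0] by eventually_elim (simp add: norm_mult norm_power)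
  qed
  then show ?thesis by (rule tendsto_norm_zero_cancel)
qed

lemma set_integrable_atLeast_iff_greaterThan:
  "set_integrable lborel {0..} f \<longleftrightarrow> set_integrable lborel {0::real<..} (f :: real \<Rightarrow> complex)"
  by (intro set_integrable_discrete_difference[where X="{0}"]) auto

lemma set_integral_atLeast_eq_greaterThan:
  "(LBINT t:{0::real..}. f t) = (LBINT t:{0<..}. (f t :: complex))"
  by (intro set_integral_discrete_difference[where X="{0}"]) auto

lemma set_integrable_power_mult_exp:
  assumes "Re z > 0"
  shows "set_integrable lborel {0..} (\<lambda>t. of_real t ^ m * exp (- z * of_real t))"
proof -
  let ?r = "Re z"
  let ?f = "\<lambda>x::real. x ^ m * exp (- x) * indicator {0..} x"
  have "integrable lborel ?f"
    using has_bochner_integral_I0i_power_exp_m' by (rule integrable.intros)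
  then have "integrable lborel (\<lambda>x. (1 / ?r ^ m) * ?f (0 + ?r * x))"
    using assms by (intro integrable_mult_right lborel_integrable_real_affine) auto
  then show ?thesis unfolding set_integrable_def
  proof (rule Bochner_Integration.integrable_bound)
    show "AE t in lborel. norm (indicat_real {0..} t *\<^sub>R (complex_of_real t ^ m * exp (- z * of_real t)))
       \<le> norm ((1 / ?r ^ m) * ?f (0 + ?r * t))"
      using assms by (intro AE_I2)
        (auto simp: norm_mult norm_power power_mult_distrib indicator_def zero_le_mult_iff)
  qed simp
qed

lemma integral_FTC_half_line:
  fixes f F :: "real \<Rightarrow> complex"
  assumes F: "\<And>t. (F has_vector_derivative f t) (at t)" and f: "continuous_on UNIV f"
    and int: "set_integrable lborel {0..} f" and lim: "(F \<longlongrightarrow> 0) at_top"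
  shows "(LBINT t:{0..}. f t) = - F 0"
proof -
  have "(LBINT t=0..\<infinity>. f t) = 0 - F 0"
  proof (rule interval_integral_FTC_integrable)
    show "set_integrable lborel (einterval 0 \<infinity>) f"
      using int by (simp add: set_integrable_atLeast_iff_greaterThan zero_ereal_def einterval_eq)
    have "(F \<longlongrightarrow> F 0) (at_right 0)"
      using has_vector_derivative_continuous[OF F[of 0]]
      by (simp add: continuous_at filterlim_at_split)
    then show "((F \<circ> real_of_ereal) \<longlongrightarrow> F 0) (at_right 0)"
      by (simp add: zero_ereal_def ereal_tendsto_simps)
    show "((F \<circ> real_of_ereal) \<longlongrightarrow> 0) (at_left \<infinity>)"
      using lim by (simp add: ereal_tendsto_simps)
    show "isCont f t" for t
      using f by (simp add: continuous_on_eq_continuous_at)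
  qed (auto intro: F)
  then show ?thesis
    by (simp add: interval_lebesgue_integral_0_infty set_integral_atLeast_eq_greaterThan)
qed

lemma exp_has_vector_derivative:
  "((\<lambda>t. exp (z * complex_of_real t)) has_vector_derivative z * exp (z * of_real t)) (at t)"
proof -
  have "((\<lambda>w. exp (z * w)) has_field_derivative z * exp (z * of_real t)) (at (of_real t))"
    by (auto intro!: derivative_eq_intros)
  then show ?thesis by (rule has_vector_derivative_real_field)
qed

lemma power_mult_exp_has_vector_derivative:
  "((\<lambda>t. complex_of_real t ^ m * exp (z * of_real t)) has_vector_derivative
     (of_nat m * of_real t ^ (m - 1) * exp (z * of_real t) + z * (of_real t ^ m * exp (z * of_real t)))) (at t)"
proof -
  have "((\<lambda>w. w ^ m * exp (z * w)) has_field_derivative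
     of_nat m * of_real t ^ (m - 1) * exp (z * of_real t) + z * (of_real t ^ m * exp (z * of_real t))) (at (of_real t))"
    by (auto intro!: derivative_eq_intros simp: algebra_simps)
  then show ?thesis by (rule has_vector_derivative_real_field)
qed

text \<open>The derivative of \<open>t\<^sup>m\<^sup>+\<^sup>1 exp (- z t)\<close> integrates to 0; this is the
  recursion of the Gamma integral.\<close>

lemma integral_power_mult_exp:
  assumes "Re z > 0"
  shows "(LBINT t:{0..}. of_real t ^ m * exp (- z * of_real t)) = fact m / z ^ Suc m"
proof (induction m)
  case 0
  have z: "z \<noteq> 0" using assms by auto
  have "(LBINT t:{0..}. of_real t ^ 0 * exp (- z * of_real t)) = - (- (1 / z) * (of_real 0 ^ 0 * exp (- z * of_real 0)))"
  proof (rule integral_FTC_half_line)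
    show "((\<lambda>t. - (1 / z) * (of_real t ^ 0 * exp (- z * of_real t))) has_vector_derivative
        of_real t ^ 0 * exp (- z * of_real t)) (at t)" for t
      using has_vector_derivative_mult_right[OF exp_has_vector_derivative[of "- z" t], of "- (1 / z)"] z
      by simp
    show "((\<lambda>t. - (1 / z) * (of_real t ^ 0 * exp (- z * of_real t))) \<longlongrightarrow> 0) at_top"
      by (rule tendsto_mult_right_zero[OF tendsto_power_mult_exp[OF assms]])
    show "set_integrable lborel {0..} (\<lambda>t. of_real t ^ 0 * exp (- z * of_real t))"
      by (rule set_integrable_power_mult_exp[OF assms])
  qed (intro continuous_intros)
  then show ?case by simp
next
  case (Suc m)
  have z: "z \<noteq> 0" using assms by auto
  let ?f = "\<lambda>m t. of_real t ^ m * exp (- z * of_real t)"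
  have int: "set_integrable lborel {0..} (?f k)" for k by (rule set_integrable_power_mult_exp[OF assms])
  have "(LBINT t:{0..}. of_nat (Suc m) * ?f m t - z * ?f (Suc m) t) = - ?f (Suc m) 0"
  proof (rule integral_FTC_half_line)
    show "(?f (Suc m) has_vector_derivative of_nat (Suc m) * ?f m t - z * ?f (Suc m) t) (at t)" for t
      using power_mult_exp_has_vector_derivative[of "Suc m" "- z" t] by (simp add: mult.assoc)
    show "(?f (Suc m) \<longlongrightarrow> 0) at_top" by (rule tendsto_power_mult_exp[OF assms])
    show "set_integrable lborel {0..} (\<lambda>t. of_nat (Suc m) * ?f m t - z * ?f (Suc m) t)"
      by (intro set_integral_diff set_integrable_mult_right int)
  qed (intro continuous_intros)
  moreover have "(LBINT t:{0..}. of_nat (Suc m) * ?f m t - z * ?f (Suc m) t)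
      = of_nat (Suc m) * (LBINT t:{0..}. ?f m t) - z * (LBINT t:{0..}. ?f (Suc m) t)"
    by (simp only: set_integral_diff(2)[OF set_integrable_mult_right[OF int] set_integrable_mult_right[OF int]]
        set_integral_mult_right)
  ultimately have "z * (LBINT t:{0..}. ?f (Suc m) t) = of_nat (Suc m) * (fact m / z ^ Suc m)"
    using Suc by simp
  then have "(LBINT t:{0..}. ?f (Suc m) t) = of_nat (Suc m) * (fact m / z ^ Suc m) / z"
    using z by (metis nonzero_mult_div_cancel_left)
  then show ?case by (simp add: mult.commute)
qed

text \<open>A scalar transform for complex-valued signals, as the exponents in the inverse transforms of partial fractions
  are complex even for real signals.\<close>

definition has_laplace_transform :: "(real \<Rightarrow> complex) \<Rightarrow> (complex \<Rightarrow> complex) \<Rightarrow> bool" where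
  "has_laplace_transform f F \<longleftrightarrow> eventually (\<lambda>s.
     set_integrable lborel {0..} (\<lambda>t. exp (- s * of_real t) * f t) \<and>
     (LBINT t:{0..}. exp (- s * of_real t) * f t) = F s) right_half_planes"

lemma has_laplace_transform_add:
  assumes "has_laplace_transform f F" "has_laplace_transform g G"
  shows "has_laplace_transform (\<lambda>t. f t + g t) (\<lambda>s. F s + G s)"
  using assms unfolding has_laplace_transform_def
proof eventually_elim
  case (elim s)
  then show ?case by (simp add: distrib_left set_integral_add)
qed

lemma has_laplace_transform_cmult:
  assumes "has_laplace_transform f F"
  shows "has_laplace_transform (\<lambda>t. c * f t) (\<lambda>s. c * F s)"
  using assms unfolding has_laplace_transform_def
proof eventually_elim
  case (elim s)
  have "(\<lambda>t. exp (- s * of_real t) * (c * f t)) = (\<lambda>t. c * (exp (- s * of_real t) * f t))"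
    by (simp add: ac_simps)
  then show ?case using elim by (simp only:) (simp add: set_integrable_mult_right)
qed

lemma has_laplace_transform_diff:
  assumes "has_laplace_transform f F" "has_laplace_transform g G"
  shows "has_laplace_transform (\<lambda>t. f t - g t) (\<lambda>s. F s - G s)"
  using has_laplace_transform_add[OF assms(1) has_laplace_transform_cmult[OF assms(2), of "-1"]] by simp

lemma has_laplace_transform_cong:
  assumes "has_laplace_transform f F" "eventually (\<lambda>s. F s = G s) right_half_planes"
  shows "has_laplace_transform f G"
  using assms unfolding has_laplace_transform_def by eventually_elim simp

lemma has_laplace_transform_monomial:
  "has_laplace_transform (\<lambda>t. of_real t ^ m * exp (z * of_real t)) (\<lambda>s. fact m / (s - z) ^ Suc m)"
  unfolding has_laplace_transform_def using eventually_Re_gt[of "Re z"]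
proof eventually_elim
  case (elim s)
  have "(\<lambda>t. exp (- s * of_real t) * (of_real t ^ m * exp (z * of_real t)))
      = (\<lambda>t. of_real t ^ m * exp (- (s - z) * of_real t))"
    by (simp add: fun_eq_iff exp_add[symmetric] algebra_simps flip: exp_add)
  then show ?case
    using elim set_integrable_power_mult_exp[of "s - z" m] integral_power_mult_exp[of "s - z" m]
    by (simp only:) simp
qed

inductive_set exponential_polynomials :: "complex set \<Rightarrow> (real \<Rightarrow> complex) set" for P where
  zero: "(\<lambda>t. 0) \<in> exponential_polynomials P"
| monomial: "z \<in> P \<Longrightarrow> (\<lambda>t. c * (of_real t ^ m * exp (z * of_real t))) \<in> exponential_polynomials P"
| add: "f \<in> exponential_polynomials P \<Longrightarrow> g \<in> exponential_polynomials P \<Longrightarrow>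
    (\<lambda>t. f t + g t) \<in> exponential_polynomials P"

lemma inverse_laplace_partial_fractions:
  assumes "F \<in> partial_fractions P"
  shows "\<exists>f\<in>exponential_polynomials P. has_laplace_transform f F"
  using assms
proof induction
  case zero
  show ?case
    by (intro bexI[OF _ exponential_polynomials.zero])
      (simp add: has_laplace_transform_def set_integrable_def set_lebesgue_integral_def)
next
  case (simple z c m)
  have "has_laplace_transform (\<lambda>t. c / fact m * (of_real t ^ m * exp (z * of_real t)))
      (\<lambda>s. c / fact m * (fact m / (s - z) ^ Suc m))"
    by (intro has_laplace_transform_cmult has_laplace_transform_monomial)
  then show ?case
    by (intro bexI[OF _ exponential_polynomials.monomial[OF simple, of "c / fact m" m]]) simp
next
  case (add F G)
  then obtain f g where f: "f \<in> exponential_polynomials P" "has_laplace_transform f F"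
    and g: "g \<in> exponential_polynomials P" "has_laplace_transform g G" by blast
  have "(\<lambda>t. f t + g t) \<in> exponential_polynomials P"
    by (rule exponential_polynomials.add[OF f(1) g(1)])
  with has_laplace_transform_add[OF f(2) g(2)] show ?case by (rule bexI)
next
  case (cong F G)
  then obtain f where f: "f \<in> exponential_polynomials P" "has_laplace_transform f F" by blast
  from has_laplace_transform_cong[OF f(2) cong.hyps(2)] f(1) show ?case by (rule bexI)
qed

lemma exponential_polynomials_derivative:
  assumes "f \<in> exponential_polynomials P"
  shows "\<exists>f'\<in>exponential_polynomials P. \<forall>t. (f has_vector_derivative f' t) (at t)"
  using assms
proof induction
  case zero
  show ?case by (intro bexI[OF _ exponential_polynomials.zero]) simp
next
  case (monomial z c m)
  have "(\<lambda>t. c * of_nat m * (of_real t ^ (m - 1) * exp (z * of_real t))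
      + c * z * (of_real t ^ m * exp (z * of_real t))) \<in> exponential_polynomials P"
    using monomial by (intro exponential_polynomials.add exponential_polynomials.monomial)
  moreover have "((\<lambda>t. c * (of_real t ^ m * exp (z * of_real t))) has_vector_derivative
      c * of_nat m * (of_real t ^ (m - 1) * exp (z * of_real t))
      + c * z * (of_real t ^ m * exp (z * of_real t))) (at t)" for t
    using has_vector_derivative_mult_right[OF power_mult_exp_has_vector_derivative[of m z t], of c]
    by (simp add: distrib_left mult.assoc)
  ultimately show ?case by (intro bexI) auto
next
  case (add f g)
  then obtain f' g' where "f' \<in> exponential_polynomials P" "g' \<in> exponential_polynomials P"
    "\<forall>t. (f has_vector_derivative f' t) (at t)" "\<forall>t. (g has_vector_derivative g' t) (at t)"
    by blast
  then show ?case
    by (intro bexI[OF _ exponential_polynomials.add[of f' P g']]) (auto intro: has_vector_derivative_add)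
qed

lemma exponential_polynomials_continuous:
  "f \<in> exponential_polynomials P \<Longrightarrow> continuous_on S f"
  by (induction rule: exponential_polynomials.induct) (auto intro!: continuous_intros)

lemma exponential_polynomials_decay:
  assumes "f \<in> exponential_polynomials {z. Re z < 0}"
  shows "(f \<longlongrightarrow> 0) at_top"
  using assms
proof induction
  case zero
  show ?case by simp
next
  case (monomial z c m)
  then show ?case using tendsto_mult_right_zero[OF tendsto_power_mult_exp[of "- z" m], of c] by simp
next
  case (add f g)
  show ?case using tendsto_add[OF add.IH] by simp
qed

section \<open>Uniqueness of the Laplace transform\<close>

text \<open>The positive and the negative part of \<open>h\<close> have equal Fourier transforms, in particular equal
  mass. Normalised, they are densities of probability measures with equal characteristic functions, and Levy's
  uniqueness theorem applies.\<close>

lemma fourier_transform_zero_imp_AE_zero: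
  fixes h :: "real \<Rightarrow> real"
  assumes int: "integrable lborel h"
    and zero: "\<And>y. (LINT t|lborel. iexp (y * t) * of_real (h t)) = 0"
  shows "AE t in lborel. h t = 0"
proof -
  define p where "p t = max 0 (h t)" for t
  define q where "q t = max 0 (- h t)" for t
  have h: "h t = p t - q t" and nn: "p t \<ge> 0" "q t \<ge> 0" for t by (auto simp: p_def q_def)
  have ip: "integrable lborel p" and iq: "integrable lborel q"
    using int unfolding p_def q_def by auto
  have bp[measurable]: "p \<in> borel_measurable borel" and bq[measurable]: "q \<in> borel_measurable borel"
    using ip iq by (auto dest: borel_measurable_integrable)
  have iexp_int: "integrable lborel (\<lambda>t. iexp (y * t) * of_real (f t))"
    if f: "integrable lborel f" for y and f :: "real \<Rightarrow> real"
  proof (rule Bochner_Integration.integrable_bound[OF f])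
    have [measurable]: "f \<in> borel_measurable borel" using f by (auto dest: borel_measurable_integrable)
    show "(\<lambda>t. iexp (y * t) * of_real (f t)) \<in> borel_measurable lborel" by measurable
  qed (simp add: norm_mult)
  have eq: "(LINT t|lborel. iexp (y * t) * of_real (p t)) = (LINT t|lborel. iexp (y * t) * of_real (q t))" for y
  proof -
    have "(LINT t|lborel. iexp (y * t) * of_real (p t) - iexp (y * t) * of_real (q t)) = 0"
      using zero[of y] by (simp add: h algebra_simps)
    then show ?thesis
      by (simp only: Bochner_Integration.integral_diff[OF iexp_int[OF ip] iexp_int[OF iq]] right_minus_eq)
  qed
  define M where "M = (LINT t|lborel. p t)"
  have Mq: "M = (LINT t|lborel. q t)" using eq[of 0] by (simp add: M_def)
  show ?thesis
  proof (cases "M = 0")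
    case True
    have "AE t in lborel. p t = 0"
      using integral_nonneg_eq_0_iff_AE[OF ip] nn True by (simp add: M_def)
    moreover have "AE t in lborel. q t = 0"
      using integral_nonneg_eq_0_iff_AE[OF iq] nn True by (simp add: Mq)
    ultimately show ?thesis by eventually_elim (simp add: h)
  next
    case False
    then have M: "M > 0"
      unfolding M_def using nn by (metis Bochner_Integration.integral_nonneg order_less_le)
    have dist: "real_distribution (density lborel (\<lambda>t. ennreal (f t / M)))"
      if f: "integrable lborel f" "(LINT t|lborel. f t) = M" "\<And>t. f t \<ge> 0" for f :: "real \<Rightarrow> real"
    proof -
      have [measurable]: "f \<in> borel_measurable borel" using f by (auto dest: borel_measurable_integrable)
      have "(\<integral>\<^sup>+ t. ennreal (f t / M) \<partial>lborel) = ennreal (LINT t|lborel. f t / M)"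
        using f M by (intro nn_integral_eq_integral) auto
      also have "\<dots> = 1" using f(2) M by simp
      finally have "prob_space (density lborel (\<lambda>t. ennreal (f t / M)))"
        by (intro prob_spaceI) (simp add: emeasure_density)
      then show ?thesis by (intro real_distribution.intro real_distribution_axioms.intro) simp_all
    qed
    have char: "char (density lborel (\<lambda>t. ennreal (f t / M))) y = (LINT t|lborel. iexp (y * t) * of_real (f t)) / M"
      if f: "integrable lborel f" "\<And>t. f t \<ge> 0" for f :: "real \<Rightarrow> real" and y
    proof -
      have [measurable]: "f \<in> borel_measurable borel" using f by (auto dest: borel_measurable_integrable)
      have "char (density lborel (\<lambda>t. ennreal (f t / M))) y = (LINT t|lborel. (f t / M) *\<^sub>R iexp (y * t))"
        unfolding char_def using f M by (intro integral_density) auto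
      also have "\<dots> = (LINT t|lborel. (iexp (y * t) * of_real (f t)) / M)"
        by (intro Bochner_Integration.integral_cong) (auto simp: scaleR_conv_of_real)
      finally show ?thesis by simp
    qed
    have "density lborel (\<lambda>t. ennreal (p t / M)) = density lborel (\<lambda>t. ennreal (q t / M))"
    proof (rule Levy_uniqueness)
      show "char (density lborel (\<lambda>t. ennreal (p t / M))) = char (density lborel (\<lambda>t. ennreal (q t / M)))"
        using char[OF ip nn(1)] char[OF iq nn(2)] eq by (simp add: fun_eq_iff)
    qed (use dist ip iq nn M_def Mq in auto)
    then have "AE t in lborel. ennreal (p t / M) = ennreal (q t / M)"
      by (intro sigma_finite_measure.density_unique[OF sigma_finite_lborel]) auto
    then show ?thesis
    proof eventually_elim
      case (elim t)
      then have "p t / M = q t / M" using nn M by simp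
      then show ?case using M by (simp add: h)
    qed
  qed
qed

lemma AE_zero_continuous_imp_zero:
  fixes g :: "real \<Rightarrow> real"
  assumes g: "continuous_on {0<..} g" and ae: "AE t in lborel. t > 0 \<longrightarrow> g t = 0" and t: "t > 0"
  shows "g t = 0"
proof (rule ccontr)
  assume "g t \<noteq> 0"
  define U where "U = {0<..} \<inter> g -` (- {0})"
  have "open U" unfolding U_def using g by (intro continuous_open_preimage) auto
  moreover have "t \<in> U" using t \<open>g t \<noteq> 0\<close> by (simp add: U_def)
  ultimately obtain e where e: "e > 0" "ball t e \<subseteq> U" by (auto elim: openE)
  have "AE x in lborel. x \<notin> ball t e"
    using ae by eventually_elim (use e in \<open>auto simp: U_def\<close>)
  then have "ball t e \<in> null_sets lborel"
    by (subst (asm) AE_iff_null_sets[symmetric]) auto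
  then have "emeasure lborel (ball t e) = 0" by auto
  then show False using e by (simp add: ball_eq_greaterThanLessThan)
qed

text \<open>On a vertical line the Laplace transform is the Fourier transform of the damped signal. Conjugation maps right
  half-planes to themselves, so the transform of \<open>cnj f\<close> vanishes too, hence that of the real part
  of \<open>f\<close>.\<close>

lemma laplace_transform_zero_imp_Re_zero:
  assumes f: "continuous_on {0<..} f" and zero: "has_laplace_transform f (\<lambda>s. 0)" and t: "t > 0"
  shows "Re (f t) = 0"
proof -
  obtain a where a: "\<And>s. a < Re s \<Longrightarrow> set_integrable lborel {0..} (\<lambda>t. exp (- s * of_real t) * f t)"
    "\<And>s. a < Re s \<Longrightarrow> (LBINT t:{0..}. exp (- s * of_real t) * f t) = 0"
    using zero unfolding has_laplace_transform_def eventually_right_half_planes_iff by blast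
  \<comment> \<open>on the line \<open>s = c - \<i> y\<close> the kernel \<open>exp (- s t)\<close> is \<open>exp (- c t)\<close> times \<open>iexp (y t)\<close>\<close>
  define c where "c = a + 1"
  define h where "h t = indicator {0..} t * (exp (- c * t) * Re (f t))" for t
  define k where "k y t = indicator {0..} t *\<^sub>R (exp (- (of_real c - \<i> * of_real y) * of_real t) * f t)" for y t
  have ik: "integrable lborel (k y)" "(LINT t|lborel. k y t) = 0" for y
    using a[of "of_real c - \<i> * of_real y"]
    by (simp_all add: k_def[abs_def] c_def set_integrable_def set_lebesgue_integral_def)
  have hk: "iexp (y * t) * of_real (h t) = (k y t + cnj (k (- y) t)) / 2" for y t
  proof -
    define e where "e = iexp (y * t) * of_real (exp (- c * t))"
    have "exp (- (of_real c - \<i> * of_real y) * of_real t) = e"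
      unfolding e_def exp_of_real[symmetric] exp_add[symmetric] by (simp add: algebra_simps)
    then have 1: "k y t = indicator {0..} t *\<^sub>R (e * f t)" by (simp add: k_def)
    have "cnj (exp (- (of_real c - \<i> * of_real (- y)) * of_real t)) = e"
      unfolding e_def exp_of_real[symmetric] exp_add[symmetric] exp_cnj by (simp add: algebra_simps)
    then have 2: "cnj (k (- y) t) = indicator {0..} t *\<^sub>R (e * cnj (f t))"
      by (simp add: k_def)
    have "of_real (Re (f t)) = (f t + cnj (f t)) / 2"
      by (simp add: complex_eq_iff)
    then have "iexp (y * t) * of_real (h t) = indicator {0..} t *\<^sub>R (e * ((f t + cnj (f t)) / 2))"
      by (simp only: h_def e_def of_real_mult scaleR_conv_of_real mult_ac)
    then show ?thesis unfolding 1 2 by (simp only: scaleR_conv_of_real) (simp add: algebra_simps)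
  qed
  have "AE t in lborel. h t = 0"
  proof (rule fourier_transform_zero_imp_AE_zero)
    have "h = (\<lambda>t. Re (k 0 t))"
      by (auto simp: h_def k_def fun_eq_iff indicator_def exp_of_real simp flip: of_real_mult of_real_minus)
    then show "integrable lborel h" using ik(1)[of 0] by simp
    show "(LINT t|lborel. iexp (y * t) * of_real (h t)) = 0" for y
      unfolding hk using ik[of y] ik[of "- y"] by simp
  qed
  then have "AE t in lborel. t > 0 \<longrightarrow> Re (f t) = 0"
    by eventually_elim (auto simp: h_def)
  then show ?thesis
    using f t by (intro AE_zero_continuous_imp_zero[where g="\<lambda>t. Re (f t)"] continuous_intros)
qed

lemma laplace_transform_unique:
  assumes "continuous_on {0<..} f" "continuous_on {0<..} g"
    and "has_laplace_transform f F" "has_laplace_transform g F" and t: "t > 0"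
  shows "f t = g t"
proof -
  define d where "d t = f t - g t" for t
  have d: "continuous_on {0<..} d" "has_laplace_transform d (\<lambda>s. 0)"
    using has_laplace_transform_diff[OF assms(3,4)] assms(1,2)
    by (auto simp: d_def[abs_def] intro: continuous_intros)
  have "Re (d t) = 0" by (rule laplace_transform_zero_imp_Re_zero[OF d t])
  moreover have "Re (- \<i> * d t) = 0"
    using d has_laplace_transform_cmult[OF d(2), of "- \<i>"]
    by (intro laplace_transform_zero_imp_Re_zero[OF _ _ t]) (auto intro!: continuous_intros)
  ultimately have "d t = 0" by (simp add: complex_eq_iff)
  then show ?thesis by (simp add: d_def)
qed

section \<open>Consensus in the frequency domain\<close>

abbreviation stable_poles :: "complex set" where
  "stable_poles \<equiv> {z. Re z < 0}"

text \<open>The invariant carried through the cascade of factors. The components may have a pole at the origin of any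
  order, which accumulates from factor to factor, but their differences have none.\<close>

definition consensus_transform :: "(complex \<Rightarrow> complex^'n) \<Rightarrow> bool" where
  "consensus_transform Z \<longleftrightarrow> (\<forall>i. (\<lambda>s. Z s $ i) \<in> proper_fractions (insert 0 stable_poles)) \<and>
     (\<forall>i j. (\<lambda>s. Z s $ i - Z s $ j) \<in> proper_fractions stable_poles)"

text \<open>Inverting one factor keeps the invariant and gains strict properness. The second claim is where the spanning
  tree enters: the differences solve an equation of the same form, with the disagreement matrix in place of the
  Laplacian.\<close>

lemma consensus_step:
  fixes X Z :: "complex \<Rightarrow> complex^'n"
  assumes L: "laplacian_of_rooted_graph L"
    and eq: "eventually (\<lambda>s. (mat s + complex_matrix L) *v X s = Z s) right_half_planes"
    and Z: "consensus_transform Z"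
  shows "(\<lambda>s. X s $ i) \<in> partial_fractions (insert 0 stable_poles)"
    and "(\<lambda>s. X s $ i - X s $ r) \<in> partial_fractions stable_poles"
proof -
  obtain W where W: "adjacency_matrix W" "has_spanning_tree W" and LW: "L = graph_laplacian W"
    using L by (auto simp: laplacian_of_rooted_graph_def)
  let ?A = "complex_matrix (graph_laplacian W)" and ?M = "disagreement_matrix r (complex_matrix (graph_laplacian W))"
  have eq': "eventually (\<lambda>s. s *s X s + ?A *v X s = Z s) right_half_planes"
    using eq by (simp add: LW matrix_vector_mult_add_rdistrib mat_mult_vec)
  show "(\<lambda>s. X s $ i) \<in> partial_fractions (insert 0 stable_poles)"
  proof (rule resolvent_partial_fractions[where B = Z])
    show "eigenvalues (- ?A) \<subseteq> insert 0 stable_poles"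
      using graph_laplacian_eigenvalue[OF W(1)] by (force simp: eigenvalues_uminus)
    show "eventually (\<lambda>s. s *s X s - (- ?A) *v X s = Z s) right_half_planes"
      using eq' by (simp add: uminus_matrix_vector_mult)
  qed (use Z in \<open>auto simp: consensus_transform_def\<close>)
  define Y where "Y s = X s + (\<chi> k. - X s $ r)" for s
  have "(\<lambda>s. Y s $ i) \<in> partial_fractions stable_poles"
  proof (rule resolvent_partial_fractions[where B = "\<lambda>s. \<chi> k. Z s $ k - Z s $ r"])
    show "eigenvalues (- ?M) \<subseteq> stable_poles"
      using disagreement_matrix_eigenvalue[OF W] by (force simp: eigenvalues_uminus)
    show "eventually (\<lambda>s. s *s Y s - (- ?M) *v Y s = (\<chi> k. Z s $ k - Z s $ r)) right_half_planes"
      using eq'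
    proof eventually_elim
      case (elim s)
      have Zs: "Z s $ k = s * X s $ k + (?A *v X s) $ k" for k
        using arg_cong[OF elim, of "\<lambda>v. v $ k"] by simp
      have AY: "?A *v Y s = ?A *v X s" unfolding Y_def by (rule graph_laplacian_shift)
      show ?case
        by (simp add: vec_eq_iff uminus_matrix_vector_mult disagreement_matrix_mult AY Zs)
          (simp add: Y_def algebra_simps)
    qed
  qed (use Z in \<open>auto simp: consensus_transform_def\<close>)
  then show "(\<lambda>s. X s $ i - X s $ r) \<in> partial_fractions stable_poles"
    by (simp add: Y_def)
qed

text \<open>The leftmost factor acts last on \<open>X\<close>, so it is the first to be inverted. Since the product splits
  off its rightmost factor, the induction hypothesis applies to the output of that factor.\<close>

lemma serial_consensus_transform:
  assumes "\<And>k. k \<in> {1..n} \<Longrightarrow> laplacian_of_rooted_graph (L k)"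
    and U: "consensus_transform U"
    and "eventually (\<lambda>s. serial_matrix n L s *v X s = U s) right_half_planes"
  shows "consensus_transform X"
  using assms(1,3)
proof (induction n arbitrary: X)
  case 0
  have "eventually (\<lambda>s. U s = X s) right_half_planes"
    using "0.prems"(2) by (auto simp: serial_matrix_def elim: eventually_mono)
  then have "eventually (\<lambda>s. U s $ i = X s $ i) right_half_planes"
    "eventually (\<lambda>s. U s $ i - U s $ j = X s $ i - X s $ j) right_half_planes" for i j
    by (auto elim: eventually_mono)
  then show ?case
    using U proper_fractions_cong[of "\<lambda>s. U s $ i" _ "\<lambda>s. X s $ i" for i]
      proper_fractions_cong[of "\<lambda>s. U s $ i - U s $ j" _ "\<lambda>s. X s $ i - X s $ j" for i j]
    unfolding consensus_transform_def by blast
next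
  case (Suc n)
  define Z where "Z s = (mat s + complex_matrix (L (Suc n))) *v X s" for s
  have "eventually (\<lambda>s. serial_matrix n L s *v Z s = U s) right_half_planes"
    using Suc.prems(2) by (simp add: serial_matrix_def Z_def matrix_vector_mul_assoc)
  then have "consensus_transform Z" using Suc by simp
  moreover have "laplacian_of_rooted_graph (L (Suc n))" using Suc.prems(1) by simp
  ultimately show ?case
    unfolding consensus_transform_def[of X]
    using consensus_step[of "L (Suc n)" X Z] by (auto simp: Z_def intro: partial_imp_proper)
qed

lemma serial_solution_transform:
  assumes n: "1 \<le> n" and L: "\<And>k. k \<in> {1..n} \<Longrightarrow> laplacian_of_rooted_graph (L k)"
    and U: "U \<in> RH_inf_vec"
    and eq: "eventually (\<lambda>s. serial_matrix n L s *v X s = U s) right_half_planes"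
  shows "(\<lambda>s. X s $ i) \<in> partial_fractions (insert 0 stable_poles)"
    and "(\<lambda>s. X s $ i - X s $ j) \<in> partial_fractions stable_poles"
proof -
  obtain m where m: "n = Suc m" using n by (cases n) auto
  have "(\<lambda>s. U s $ i) \<in> proper_fractions stable_poles" for i
    using U by (auto simp: RH_inf_vec_def intro: RH_inf_proper)
  then have U': "consensus_transform U"
    unfolding consensus_transform_def
    by (auto intro!: proper_fractions_diff intro: proper_fractions_mono[where P = stable_poles])
  define Z where "Z s = (mat s + complex_matrix (L n)) *v X s" for s
  have "eventually (\<lambda>s. serial_matrix m L s *v Z s = U s) right_half_planes"
    using eq by (simp add: m serial_matrix_def Z_def matrix_vector_mul_assoc)
  then have Z: "consensus_transform Z"
    using L U' m by (intro serial_consensus_transform[of m L U Z]) auto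
  have "laplacian_of_rooted_graph (L n)" using L n by simp
  from consensus_step[OF this _ Z, of X]
  show "(\<lambda>s. X s $ i) \<in> partial_fractions (insert 0 stable_poles)"
    "(\<lambda>s. X s $ i - X s $ j) \<in> partial_fractions stable_poles"
    by (auto simp: Z_def)
qed

section \<open>Consensus in the time domain\<close>

text \<open>A signal is known to be the real part of an exponential polynomial only at positive times; differentiability
  is local, so it transfers on this open half-line.\<close>

lemma real_signal_derivative:
  fixes g :: "real \<Rightarrow> real"
  assumes "f \<in> exponential_polynomials P" and g: "\<And>t. t > 0 \<Longrightarrow> g t = Re (f t)"
  obtains f' where "f' \<in> exponential_polynomials P"
    "\<And>t. t > 0 \<Longrightarrow> (g has_real_derivative Re (f' t)) (at t)"
proof -
  obtain f' where f': "f' \<in> exponential_polynomials P" "\<And>t. (f has_vector_derivative f' t) (at t)"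
    using exponential_polynomials_derivative[OF assms(1)] by blast
  have "(g has_real_derivative Re (f' t)) (at t)" if "t > 0" for t
  proof (rule has_field_derivative_transform_within_open)
    show "((\<lambda>t. Re (f t)) has_real_derivative Re (f' t)) (at t)"
      using bounded_linear.has_vector_derivative[OF bounded_linear_Re f'(2)]
      by (simp add: has_real_derivative_iff_has_vector_derivative)
  qed (use that g in \<open>auto intro: open_greaterThan\<close>)
  with f'(1) show thesis by (rule that)
qed

text \<open>Three representations are differentiated in parallel. The one for the difference is needed with its own set of
  exponents \<open>Q\<close>, and uniqueness of derivatives keeps it in step with the other two.\<close>

lemma iterated_derivatives:
  fixes g1 g2 :: "real \<Rightarrow> real"
  assumes "f1 \<in> exponential_polynomials P" "f2 \<in> exponential_polynomials P" "h \<in> exponential_polynomials Q"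
    and "\<And>t. t > 0 \<Longrightarrow> g1 t = Re (f1 t)" "\<And>t. t > 0 \<Longrightarrow> g2 t = Re (f2 t)"
    "\<And>t. t > 0 \<Longrightarrow> g1 t - g2 t = Re (h t)"
  shows "\<exists>f1\<in>exponential_polynomials P. \<exists>f2\<in>exponential_polynomials P. \<exists>h\<in>exponential_polynomials Q.
    \<forall>t>0. (deriv ^^ k) g1 t = Re (f1 t) \<and> (deriv ^^ k) g2 t = Re (f2 t) \<and>
      (deriv ^^ k) g1 t - (deriv ^^ k) g2 t = Re (h t)"
proof (induction k)
  case 0
  show ?case
    by (rule bexI[OF _ assms(1)], rule bexI[OF _ assms(2)], rule bexI[OF _ assms(3)])
      (use assms(4-6) in simp)
next
  case (Suc k)
  then obtain f1 f2 h where f1: "f1 \<in> exponential_polynomials P" "\<And>t. t > 0 \<Longrightarrow> (deriv ^^ k) g1 t = Re (f1 t)"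
    and f2: "f2 \<in> exponential_polynomials P" "\<And>t. t > 0 \<Longrightarrow> (deriv ^^ k) g2 t = Re (f2 t)"
    and h: "h \<in> exponential_polynomials Q"
      "\<And>t. t > 0 \<Longrightarrow> (deriv ^^ k) g1 t - (deriv ^^ k) g2 t = Re (h t)"
    by blast
  obtain f1' where f1': "f1' \<in> exponential_polynomials P"
    "\<And>t. t > 0 \<Longrightarrow> ((deriv ^^ k) g1 has_real_derivative Re (f1' t)) (at t)"
    using real_signal_derivative[OF f1] by blast
  obtain f2' where f2': "f2' \<in> exponential_polynomials P"
    "\<And>t. t > 0 \<Longrightarrow> ((deriv ^^ k) g2 has_real_derivative Re (f2' t)) (at t)"
    using real_signal_derivative[OF f2] by blast
  obtain h' where h': "h' \<in> exponential_polynomials Q"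
    "\<And>t. t > 0 \<Longrightarrow> ((\<lambda>t. (deriv ^^ k) g1 t - (deriv ^^ k) g2 t) has_real_derivative Re (h' t)) (at t)"
    using real_signal_derivative[OF h] by blast
  have 1: "(deriv ^^ Suc k) g1 t = Re (f1' t)" and 2: "(deriv ^^ Suc k) g2 t = Re (f2' t)" if "t > 0" for t
    using f1'(2)[OF that] f2'(2)[OF that] by (simp_all add: DERIV_imp_deriv)
  have 3: "(deriv ^^ Suc k) g1 t - (deriv ^^ Suc k) g2 t = Re (h' t)" if "t > 0" for t
    unfolding 1[OF that] 2[OF that]
    by (rule DERIV_unique[OF DERIV_diff[OF f1'(2)[OF that] f2'(2)[OF that]] h'(2)[OF that]])
  show ?case
    by (rule bexI[OF _ f1'(1)], rule bexI[OF _ f2'(1)], rule bexI[OF _ h'(1)])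
      (intro allI impI conjI 1 2 3)
qed

text \<open>Uniqueness of the transform identifies each component and each difference with an exponential polynomial, at
  every positive time because both sides are continuous there.\<close>

lemma serial_consensus_solution_achieves_consensus:
  fixes x :: "real \<Rightarrow> real^'n"
  assumes n: "1 \<le> n" and L: "\<And>k. k \<in> {1..n} \<Longrightarrow> laplacian_of_rooted_graph (L k)"
    and U: "U \<in> RH_inf_vec" and x: "serial_consensus_solution n L U x"
  shows "achieves_consensus n x"
proof -
  have cont: "continuous_on {0<..} (\<lambda>t. complex_of_real (x t $ i))" for i
    using x by (auto simp: serial_consensus_solution_def intro!: continuous_intros)
  have ev: "eventually (\<lambda>s. laplace_converges x s \<and> serial_matrix n L s *v laplace x s = U s) right_half_planes"
    using x by (simp add: serial_consensus_solution_def eventually_right_half_planes_iff)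
  then have eq: "eventually (\<lambda>s. serial_matrix n L s *v laplace x s = U s) right_half_planes"
    by eventually_elim simp
  have transform: "has_laplace_transform (\<lambda>t. of_real (x t $ i)) (\<lambda>s. laplace x s $ i)" for i
    unfolding has_laplace_transform_def using ev
    by eventually_elim (simp add: laplace_converges_def laplace_def)
  have signal: "\<exists>f\<in>exponential_polynomials (insert 0 stable_poles). \<forall>t>0. x t $ i = Re (f t)" for i
  proof -
    obtain f where f: "f \<in> exponential_polynomials (insert 0 stable_poles)"
      "has_laplace_transform f (\<lambda>s. laplace x s $ i)"
      using inverse_laplace_partial_fractions[OF serial_solution_transform(1)[OF n L U eq]] by blast
    have "of_real (x t $ i) = f t" if "t > 0" for t
      by (rule laplace_transform_unique[OF cont exponential_polynomials_continuous[OF f(1)] transform f(2) that])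
    then show ?thesis by (intro bexI[OF _ f(1)]) (metis Re_complex_of_real)
  qed
  have difference: "\<exists>h\<in>exponential_polynomials stable_poles. \<forall>t>0. x t $ i - x t $ j = Re (h t)" for i j
  proof -
    obtain h where h: "h \<in> exponential_polynomials stable_poles"
      "has_laplace_transform h (\<lambda>s. laplace x s $ i - laplace x s $ j)"
      using inverse_laplace_partial_fractions[OF serial_solution_transform(2)[OF n L U eq]] by blast
    have "of_real (x t $ i) - of_real (x t $ j) = h t" if "t > 0" for t
      by (rule laplace_transform_unique[OF continuous_on_diff[OF cont cont] exponential_polynomials_continuous[OF h(1)]
          has_laplace_transform_diff[OF transform transform] h(2) that])
    then show ?thesis by (intro bexI[OF _ h(1)]) (metis Re_complex_of_real of_real_diff)
  qed
  have derivs: "\<exists>f1\<in>exponential_polynomials (insert 0 stable_poles).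
      \<exists>f2\<in>exponential_polynomials (insert 0 stable_poles). \<exists>h\<in>exponential_polynomials stable_poles.
    \<forall>t>0. (deriv ^^ k) (\<lambda>t. x t $ i) t = Re (f1 t) \<and> (deriv ^^ k) (\<lambda>t. x t $ j) t = Re (f2 t) \<and>
      (deriv ^^ k) (\<lambda>t. x t $ i) t - (deriv ^^ k) (\<lambda>t. x t $ j) t = Re (h t)" for i j k
  proof -
    obtain f1 where "f1 \<in> exponential_polynomials (insert 0 stable_poles)" "\<forall>t>0. x t $ i = Re (f1 t)"
      using signal by blast
    moreover obtain f2 where "f2 \<in> exponential_polynomials (insert 0 stable_poles)" "\<forall>t>0. x t $ j = Re (f2 t)"
      using signal by blast
    moreover obtain h where "h \<in> exponential_polynomials stable_poles" "\<forall>t>0. x t $ i - x t $ j = Re (h t)"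
      using difference by blast
    ultimately show ?thesis by (intro iterated_derivatives) auto
  qed
  show ?thesis
    unfolding achieves_consensus_def
  proof (intro conjI allI impI)
    fix i k and t :: real
    assume "t > 0"
    obtain f where f: "f \<in> exponential_polynomials (insert 0 stable_poles)"
      "\<forall>t>0. (deriv ^^ k) (\<lambda>t. x t $ i) t = Re (f t)"
      using derivs[of k i i] by blast
    obtain f' where "\<And>t. t > 0 \<Longrightarrow> ((deriv ^^ k) (\<lambda>t. x t $ i) has_real_derivative Re (f' t)) (at t)"
      using real_signal_derivative[OF f(1)] f(2) by blast
    then show "(deriv ^^ k) (\<lambda>t. x t $ i) field_differentiable at t"
      using \<open>t > 0\<close> by (auto simp: field_differentiable_def)
  next
    fix i j k
    obtain h where h: "h \<in> exponential_polynomials stable_poles"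
      "\<forall>t>0. (deriv ^^ k) (\<lambda>t. x t $ i) t - (deriv ^^ k) (\<lambda>t. x t $ j) t = Re (h t)"
      using derivs[of k i j] by blast
    have "((\<lambda>t. \<bar>Re (h t)\<bar>) \<longlongrightarrow> 0) at_top"
      using tendsto_rabs[OF tendsto_Re[OF exponential_polynomials_decay[OF h(1)]]] by simp
    then show "((\<lambda>t. \<bar>(deriv ^^ k) (\<lambda>t. x t $ i) t - (deriv ^^ k) (\<lambda>t. x t $ j) t\<bar>) \<longlongrightarrow> 0) at_top"
    proof (rule Lim_transform_eventually)
      show "\<forall>\<^sub>F t in at_top. \<bar>Re (h t)\<bar> = \<bar>(deriv ^^ k) (\<lambda>t. x t $ i) t - (deriv ^^ k) (\<lambda>t. x t $ j) t\<bar>"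
        using eventually_gt_at_top[of 0] by eventually_elim (simp add: h(2))
    qed
  qed
qed

theorem theorem4:
  fixes n :: nat
    and L :: "nat \<Rightarrow> real^'n^'n"
    and U_ref :: "complex \<Rightarrow> complex^'n"
  assumes "1 \<le> n"
    and "\<And>k. k \<in> {1..n} \<Longrightarrow> laplacian_of_rooted_graph (L k)"
    and "U_ref \<in> RH_inf_vec"
  shows "closed_loop_poles n L = (\<Union>k\<in>{1..n}. eigenvalues (complex_matrix (- L k))) \<and>
    (\<forall>x. serial_consensus_solution n L U_ref x \<longrightarrow> achieves_consensus n x)"
  using closed_loop_poles_eq serial_consensus_solution_achieves_consensus[OF assms]
  by (intro conjI allI impI)

end
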